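(* For a positive integer $q$ and real $X>0$ let $R(X,q)$ denote the number of residue classes $a \bmod q$ that contain a prime $p<X$ (i.e. for which there is a prime $p<X$ with $p\equiv a \pmod q$). (i) For every fixed $\lambda>0$ there exist $c=c(\lambda)>0$ and $q_0=q_0(\lambda)$ such that for every integer $q\ge q_0$ and every real $X\ge \lambda\,\varphi(q)\log q$ one has $R(X,q)\ge c\,\varphi(q)$. (ii) Conversely, for every fixed $c>0$ there exists $c'=c'(c)>0$ such that, for all sufficiently large $q$, if $R(X,q)\ge c\,\varphi(q)$ then $X\ge c'\,\varphi(q)\log q$.
   Context: $\varphi$ is Euler's totient function and $\log$ is the natural logarithm. "A positive proportion of congruence classes modulo $q$" means at least a fixed positive constant times $\varphi(q)$ of them. *)

theory Defs
  imports Complex_Main "HOL-Number_Theory.Number_Theory"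
begin

text \<open>Residue classes modulo \<open>q > 0\<close> are represented by their least nonnegative
  representatives. Classes not coprime to \<open>q\<close> are included: such a class counts if it
  contains a prime below \<open>X\<close>, necessarily a prime divisor of \<open>q\<close>.\<close>

definition prime_residue_count :: "real \<Rightarrow> nat \<Rightarrow> nat" where
  "prime_residue_count X q =
     card {a \<in> {0..<q}. \<exists>p::nat. prime p \<and> real p < X \<and> [p = a] (mod q)}"

end

theory Submission
  imports Defs "HOL-Computational_Algebra.Squarefree" "HOL-Analysis.Harmonic_Numbers"
    "HOL-Real_Asymp.Real_Asymp"
begin

text \<open>For the lower bound take \<open>X\<close> of size \<open>\<lambda> \<phi>(q) log q\<close>, so that \<open>\<pi>(X) \<ge> \<lambda> \<phi>(q) / 8\<close> by Chebyshev. By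
  Cauchy--Schwarz it suffices that the number of pairs of primes \<open>n\<close>, \<open>n + k q\<close> below \<open>X\<close> is
  \<open>O(\<phi>(q))\<close>. For fixed \<open>k\<close>, Selberg's sieve of level a small power of \<open>q\<close> bounds it by a multiple of
  \<open>X / log\<^sup>2 q\<close> times the product of \<open>1 + 1/p\<close> over \<open>p | k q\<close>; the primes dividing \<open>q\<close> contribute at
  most \<open>q / \<phi>(q)\<close>, those dividing \<open>k\<close> are bounded on average, and there are at most \<open>X / q\<close> values of \<open>k\<close>.
  The converse is the upper bound \<open>\<pi>(X) = O(X / log X)\<close>, which the same sieve gives.\<close>

section \<open>Selberg's sieve\<close>

text \<open>Since \<phi>(q)/q can tend to 0, every estimate has to be of size \<phi>(q) rather than
  q. The orders match exactly: about X/q shifts, each with O((X / log^2 q) (q / \<phi>(q))) pairs on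
  average, give O(X^2 / (\<phi>(q) log^2 q)), which is O(\<phi>(q)) at X = \<lambda> \<phi>(q) log
  q. For X < q there are no shifts and no collisions. Larger X follow by monotonicity. Only orders
  of magnitude matter, so the sieve is used in a dual form: a square that is constant on the sifted
  set replaces the usual divisor-sum weights and their optimisation. Its crude remainder, a fixed
  power of the level, is harmless because the level is a small power of q while \<phi>(q) is at
  least q / (log_2 q + 1). An upper bound sieve cannot bound the number of primes from below; that
  bound comes from the growth of lcm(1, ..., n).\<close>

lemma sum_coprime_periodic:
  fixes f g :: "nat \<Rightarrow> 'a :: comm_semiring_1"
  assumes "coprime m p" "m > 0" "p > 0"
    and f: "\<And>n. f (n mod m) = f n" and g: "\<And>n. g (n mod p) = g n"
  shows "(\<Sum>n<m * p. f n * g n) = (\<Sum>n<m. f n) * (\<Sum>r<p. g r)"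
proof -
  let ?\<phi> = "\<lambda>n. (n mod m, n mod p)"
  have inj: "inj_on ?\<phi> {..<m * p}"
  proof (rule inj_onI)
    fix x y assume "x \<in> {..<m * p}" "y \<in> {..<m * p}" "?\<phi> x = ?\<phi> y"
    then have "[x = y] (mod m)" "[x = y] (mod p)" "x < m * p" "y < m * p"
      by (auto simp: unique_euclidean_semiring_class.cong_def)
    then show "x = y"
      using coprime_cong_mult_nat[OF _ _ \<open>coprime m p\<close>] cong_less_modulus_unique_nat by blast
  qed
  have "?\<phi> ` {..<m * p} \<subseteq> {..<m} \<times> {..<p}" using assms by auto
  moreover have "card (?\<phi> ` {..<m * p}) = card ({..<m} \<times> {..<p})"
    using inj by (simp add: card_image)
  ultimately have im: "?\<phi> ` {..<m * p} = {..<m} \<times> {..<p}"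
    by (intro card_subset_eq) auto
  have "(\<Sum>n<m * p. f n * g n) = (\<Sum>n<m * p. (\<lambda>(a, b). f a * g b) (?\<phi> n))"
    by (simp add: f g)
  also have "\<dots> = (\<Sum>(a, b)\<in>{..<m} \<times> {..<p}. f a * g b)"
    unfolding im[symmetric] by (subst sum.reindex[OF inj]) simp
  also have "\<dots> = (\<Sum>n<m. f n) * (\<Sum>r<p. g r)"
    by (simp add: sum_product sum.cartesian_product)
  finally show ?thesis .
qed

text \<open>The Chinese remainder theorem, one prime at a time. It reduces correlations of the sieve
  functions over a full period to computations modulo single primes.\<close>

lemma sum_prod_periodic:
  fixes F :: "nat \<Rightarrow> nat \<Rightarrow> 'a :: comm_semiring_1"
  assumes "finite U" "\<And>p. p \<in> U \<Longrightarrow> prime p" "\<And>p n. p \<in> U \<Longrightarrow> F p (n mod p) = F p n"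
  shows "(\<Sum>n<\<Prod>U. \<Prod>p\<in>U. F p n) = (\<Prod>p\<in>U. \<Sum>r<p. F p r)"
  using assms
proof (induction U rule: finite_induct)
  case empty
  then show ?case by simp
next
  case (insert p U)
  have cop: "coprime (\<Prod>U) p"
    using insert by (intro prod_coprime_left) (auto intro: primes_coprime)
  have per: "(\<Prod>q\<in>U. F q (n mod \<Prod>U)) = (\<Prod>q\<in>U. F q n)" for n
  proof (rule prod.cong)
    fix q assume q: "q \<in> U"
    then have "q dvd \<Prod>U" using insert by (intro dvd_prodI) auto
    then have "n mod \<Prod>U mod q = n mod q" by (simp add: mod_mod_cancel)
    then show "F q (n mod \<Prod>U) = F q n"
      using insert.prems(2)[of q "n mod \<Prod>U"] insert.prems(2)[of q n] q by simp
  qed simp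
  have pos: "\<Prod>U > 0" using insert by (auto intro!: prod_pos simp: prime_gt_0_nat)
  have "(\<Sum>n<\<Prod>(insert p U). \<Prod>q\<in>insert p U. F q n) =
        (\<Sum>n<\<Prod>U * p. (\<Prod>q\<in>U. F q n) * F p n)"
    using insert by (simp add: mult.commute)
  also have "\<dots> = (\<Sum>n<\<Prod>U. \<Prod>q\<in>U. F q n) * (\<Sum>r<p. F p r)"
    using cop pos per insert.prems by (intro sum_coprime_periodic) (auto simp: prime_gt_0_nat)
  also have "\<dots> = (\<Prod>q\<in>insert p U. \<Sum>r<q. F q r)"
    using insert by (simp add: mult.commute)
  finally show ?case .
qed

lemma sum_periodic:
  fixes f :: "nat \<Rightarrow> 'a :: comm_semiring_1"
  assumes "\<And>n. f (n mod m) = f n"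
  shows "(\<Sum>n<N. f n) = of_nat (N div m) * (\<Sum>n<m. f n) + (\<Sum>n<N mod m. f n)"
proof -
  have blocks: "(\<Sum>n<t * m + r. f n) = of_nat t * (\<Sum>n<m. f n) + (\<Sum>n<r. f n)" for t r
  proof (induction t)
    case (Suc t)
    have "(\<Sum>n<m + k. f n) = (\<Sum>n<m. f n) + (\<Sum>n<k. f n)" for k
    proof (induction k)
      case (Suc k)
      have "f (m + k) = f k" using assms[of "m + k"] assms[of k] by simp
      then show ?case using Suc by (simp add: algebra_simps)
    qed simp
    from this[of "t * m + r"] Suc show ?case by (simp add: algebra_simps)
  qed simp
  show ?thesis using blocks[of "N div m" "N mod m"] by simp
qed

text \<open>A set stands for the squarefree number that is its product, the empty set for 1.
  Multiplicative functions of that number become plain products over the set.\<close>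

definition prime_sets :: "nat \<Rightarrow> nat set set" where
  "prime_sets R = {S. finite S \<and> (\<forall>p\<in>S. prime p) \<and> \<Prod>S \<le> R}"

lemma prime_setsD:
  assumes "S \<in> prime_sets R"
  shows "finite S" "\<And>p. p \<in> S \<Longrightarrow> prime p" "\<Prod>S \<le> R" "\<Prod>S > 0"
  using assms by (auto simp: prime_sets_def prime_gt_0_nat intro!: prod_pos)

lemma prime_sets_le:
  assumes "S \<in> prime_sets R" "p \<in> S"
  shows "p \<le> R"
proof -
  have "p dvd \<Prod>S" using assms prime_setsD by (intro dvd_prodI) auto
  then have "p \<le> \<Prod>S" using prime_setsD[OF assms(1)] by (intro dvd_imp_le) auto
  then show ?thesis using prime_setsD(3)[OF assms(1)] by simp
qed

lemma finite_prime_sets [simp]: "finite (prime_sets R)"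
proof (rule finite_subset)
  show "prime_sets R \<subseteq> Pow {..R}" using prime_sets_le by auto
qed simp

lemma empty_in_prime_sets: "R > 0 \<Longrightarrow> {} \<in> prime_sets R"
  by (simp add: prime_sets_def)

text \<open>The weight \<open>(1/G) \<Sum>\<^sub>S h\<^sub>S \<Prod>\<^bsub>p\<in>S\<^esub> \<psi>\<^sub>p\<close> equals 1 on sifted numbers; since the \<open>\<psi>\<^sub>p\<close> have
  mean zero, distinct \<open>S\<close> are orthogonal over full periods and its mean square is \<open>1/G\<close>.\<close>

theorem selberg_sieve:
  fixes B :: "nat \<Rightarrow> nat set" and N R :: nat and h :: "nat \<Rightarrow> real"
  assumes B: "\<And>p. prime p \<Longrightarrow> p \<le> R \<Longrightarrow> B p \<subseteq> {..<p}"
    and B0: "\<And>p. prime p \<Longrightarrow> p \<le> R \<Longrightarrow> B p \<noteq> {}"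
    and Bp: "\<And>p. prime p \<Longrightarrow> p \<le> R \<Longrightarrow> card (B p) < p"
    and R: "R > 0"
    and h: "\<And>p. prime p \<Longrightarrow> p \<le> R \<Longrightarrow> h p = card (B p) / (real p - card (B p))"
  defines "G \<equiv> (\<Sum>S\<in>prime_sets R. \<Prod>p\<in>S. h p)"
  shows "real (card {n. n < N \<and> (\<forall>p. prime p \<longrightarrow> p \<le> R \<longrightarrow> n mod p \<notin> B p)})
           \<le> (real N + real R) / G + real R ^ 4"
proof -
  define b where "b p = real (card (B p))" for p
  define \<psi> where "\<psi> p n = (if n mod p \<in> B p then 1 - real p / b p else 1)" for p n
  define \<Psi> where "\<Psi> S n = (\<Prod>p\<in>S. \<psi> p n)" for S n
  define H where "H S = (\<Prod>p\<in>S. h p)" for S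
  define D where "D = prime_sets R"
  define F where "F n = (\<Sum>S\<in>D. H S * \<Psi> S n)" for n
  define A where "A = {n. n < N \<and> (\<forall>p. prime p \<longrightarrow> p \<le> R \<longrightarrow> n mod p \<notin> B p)}"
  have finB: "finite (B p)" if "prime p" "p \<le> R" for p
    using B[OF that] finite_subset by blast
  have b: "1 \<le> b p" "b p < p" if "prime p" "p \<le> R" for p
  proof -
    have "card (B p) > 0" using finB B0 that by (simp add: card_gt_0_iff)
    then show "1 \<le> b p" by (simp add: b_def)
  qed (use Bp that in \<open>simp add: b_def\<close>)
  have hb: "h p = b p / (p - b p)" if "prime p" "p \<le> R" for p using h that by (simp add: b_def)
  have hpos: "h p > 0" if "prime p" "p \<le> R" for p using hb b[OF that] that by simp
  have DD: "finite S" "\<And>p. p \<in> S \<Longrightarrow> prime p \<and> p \<le> R" "\<Prod>S \<le> R" "\<Prod>S > 0" if "S \<in> D" for S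
    using prime_setsD prime_sets_le that unfolding D_def by auto
  have Hpos: "H S > 0" if "S \<in> D" for S
    unfolding H_def using DD[OF that] hpos by (intro prod_pos) auto
  have finD: "finite D" by (simp add: D_def)
  have GD: "G = sum H D" by (simp add: G_def D_def H_def)
  have "{} \<in> D" using R by (simp add: D_def empty_in_prime_sets)
  then have Gpos: "G > 0" unfolding GD using Hpos finD by (intro sum_pos) auto
  have \<psi>per: "\<psi> p (n mod p) = \<psi> p n" for p n by (simp add: \<psi>_def)
  \<comment> \<open>The value 1 - p/b on \<open>B p\<close> is forced by mean zero: b (1 - p/b) + (p
    - b) = 0. The squares then add up to (p - b)^2 / b + (p - b) = p (p - b) / b = p / h.\<close>
  have \<psi>sum: "(\<Sum>r<p. \<psi> p r) = 0" "(\<Sum>r<p. \<psi> p r * \<psi> p r) = real p / h p"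
    if p: "prime p" "p \<le> R" for p
  proof -
    have sp: "(\<Sum>r<p. if r mod p \<in> B p then x else 1) = b p * x + (real p - b p)" for x :: real
    proof -
      have "(\<Sum>r<p. if r mod p \<in> B p then x else 1) = (\<Sum>r<p. if r \<in> B p then x else 1)"
        by (intro sum.cong) auto
      also have "\<dots> = (\<Sum>r\<in>B p. x) + (\<Sum>r\<in>{..<p} - B p. 1)"
        using B[OF p] by (subst sum.If_cases) (auto simp: Int_absorb1 Diff_eq)
      also have "\<dots> = b p * x + (real p - b p)"
        using B[OF p] finB[OF p] Bp[OF p] by (simp add: b_def card_Diff_subset of_nat_diff)
      finally show ?thesis .
    qed
    show "(\<Sum>r<p. \<psi> p r) = 0"
      unfolding \<psi>_def sp using b[OF p] by (simp add: field_simps)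
    have "(\<Sum>r<p. \<psi> p r * \<psi> p r) = (\<Sum>r<p. if r mod p \<in> B p then (1 - real p / b p)\<^sup>2 else 1)"
      by (intro sum.cong) (auto simp: \<psi>_def power2_eq_square)
    also have "\<dots> = real p / h p"
      unfolding sp hb[OF p] using b[OF p] by (simp add: field_simps power2_eq_square)
    finally show "(\<Sum>r<p. \<psi> p r * \<psi> p r) = real p / h p" .
  qed
  have \<psi>abs: "\<bar>\<psi> p n\<bar> \<le> p" if "prime p" "p \<le> R" for p n
  proof -
    have "p / b p \<le> p" "p / b p \<ge> 1" using b[OF that] by (auto simp: field_simps mult_le_cancel_left1)
    then show ?thesis by (auto simp: \<psi>_def)
  qed
  have \<Psi>abs: "\<bar>\<Psi> S n\<bar> \<le> R" if "S \<in> D" for S n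
  proof -
    have "\<bar>\<Psi> S n\<bar> \<le> (\<Prod>p\<in>S. real p)"
      unfolding \<Psi>_def abs_prod using \<psi>abs DD[OF that] by (intro prod_mono) auto
    also have "\<dots> = real (\<Prod>S)" by simp
    also have "\<dots> \<le> R" using DD[OF that] by (simp del: of_nat_prod)
    finally show ?thesis .
  qed
  \<comment> \<open>The summands are squares, so the incomplete last period costs at most a full
    one. A full period sums to its length over \<open>H S\<close>, and the length is at most
    \<open>R\<close>, whence N + R.\<close>
  have diag: "(\<Sum>n<N. \<Psi> S n * \<Psi> S n) \<le> (real N + R) / H S" if S: "S \<in> D" for S
  proof -
    let ?f = "\<lambda>n. \<Psi> S n * \<Psi> S n" and ?m = "\<Prod>S"
    have f: "?f n = (\<Prod>p\<in>S. \<psi> p n * \<psi> p n)" for n by (simp add: \<Psi>_def prod.distrib)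
    have "\<Psi> S (n mod ?m) = \<Psi> S n" for n
      unfolding \<Psi>_def
    proof (rule prod.cong)
      fix q assume q: "q \<in> S"
      then have "q dvd ?m" using DD[OF S] by (intro dvd_prodI) auto
      then show "\<psi> q (n mod ?m) = \<psi> q n" by (simp add: \<psi>_def mod_mod_cancel)
    qed simp
    then have "(\<Sum>n<N. ?f n) = real (N div ?m) * (\<Sum>n<?m. ?f n) + (\<Sum>n<N mod ?m. ?f n)"
      by (intro sum_periodic) simp
    also have "(\<Sum>n<N mod ?m. ?f n) \<le> (\<Sum>n<?m. ?f n)"
      using DD[OF S] by (intro sum_mono2) (auto intro: order.strict_trans)
    also have "(\<Sum>n<?m. ?f n) = (\<Prod>p\<in>S. \<Sum>r<p. \<psi> p r * \<psi> p r)"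
      unfolding f using DD[OF S] \<psi>per by (intro sum_prod_periodic) auto
    also have "\<dots> = ?m / H S"
      unfolding H_def using DD[OF S] \<psi>sum by (simp add: prod_dividef)
    also have "real (N div ?m) * (?m / H S) + ?m / H S = (real (N div ?m) * ?m + ?m) / H S"
      by (simp add: add_divide_distrib del: of_nat_prod)
    also have "\<dots> \<le> (real N + R) / H S"
    proof -
      have "real (N div ?m) * ?m \<le> N"
        using of_nat_mono[OF div_times_less_eq_dividend[of N ?m]] by (simp del: of_nat_prod)
      moreover have "real ?m \<le> R" using DD[OF S] by (simp del: of_nat_prod)
      ultimately show ?thesis using Hpos[OF S]
        by (intro divide_right_mono add_mono) auto
    qed
    finally show ?thesis by simp
  qed
  \<comment> \<open>A prime lying in only one of \<open>S\<close> and \<open>T\<close> contributes a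
    factor of mean zero, so full periods cancel. What remains has fewer than R^2 terms, because the
    period divides \<Prod>S * \<Prod>T, and each term is at most R^2.\<close>
  have off: "(\<Sum>n<N. \<Psi> S n * \<Psi> T n) \<le> real R ^ 4" if S: "S \<in> D" and T: "T \<in> D" and ST: "S \<noteq> T" for S T
  proof -
    let ?f = "\<lambda>n. \<Psi> S n * \<Psi> T n" and ?U = "S \<union> T"
    let ?m = "\<Prod>?U"
    have finU: "finite ?U" using DD S T by auto
    define E where "E p n = (if p \<in> S then \<psi> p n else 1) * (if p \<in> T then \<psi> p n else 1)" for p n
    have f: "?f n = (\<Prod>p\<in>?U. E p n)" for n
    proof -
      have "\<Psi> S n = (\<Prod>p\<in>?U. if p \<in> S then \<psi> p n else 1)"
        unfolding \<Psi>_def using finU by (subst prod.inter_restrict[symmetric]) (auto intro: prod.cong)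
      moreover have "\<Psi> T n = (\<Prod>p\<in>?U. if p \<in> T then \<psi> p n else 1)"
        unfolding \<Psi>_def using finU by (subst prod.inter_restrict[symmetric]) (auto intro: prod.cong)
      ultimately show ?thesis by (simp add: E_def prod.distrib)
    qed
    have Eper: "E p (n mod p) = E p n" for p n by (simp add: E_def \<psi>per)
    have per: "?f (n mod ?m) = ?f n" for n
      unfolding f
    proof (rule prod.cong)
      fix q assume q: "q \<in> ?U"
      then have "q dvd ?m" using finU by (intro dvd_prodI) auto
      then show "E q (n mod ?m) = E q n" by (simp add: E_def \<psi>_def mod_mod_cancel)
    qed simp
    obtain p where p: "p \<in> ?U" "p \<notin> S \<or> p \<notin> T" using ST by blast
    have "(\<Sum>n<?m. ?f n) = (\<Prod>p\<in>?U. \<Sum>r<p. E p r)"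
      unfolding f using DD[OF S] DD[OF T] Eper by (intro sum_prod_periodic) auto
    moreover have "(\<Sum>r<p. E p r) = 0"
      using p \<psi>sum(1)[of p] DD[OF S] DD[OF T] by (auto simp: E_def)
    ultimately have zero: "(\<Sum>n<?m. ?f n) = 0" using p finU by (auto simp: prod_zero_iff)
    have "?m * \<Prod>(S \<inter> T) = \<Prod>S * \<Prod>T" using DD[OF S] DD[OF T] by (simp add: prod.union_inter)
    moreover have "\<Prod>(S \<inter> T) > 0" using DD[OF S] by (intro prod_pos) (auto simp: prime_gt_0_nat)
    ultimately have "?m dvd \<Prod>S * \<Prod>T" by (metis dvd_triv_left)
    then have "?m \<le> \<Prod>S * \<Prod>T" using DD[OF S] DD[OF T] by (intro dvd_imp_le) auto
    also have "\<dots> \<le> R * R" using DD[OF S] DD[OF T] by (intro mult_mono) auto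
    finally have mR: "?m \<le> R * R" .
    have mpos: "?m > 0" using DD[OF S] DD[OF T] by (intro prod_pos) (auto simp: prime_gt_0_nat)
    have "(\<Sum>n<N. ?f n) = (\<Sum>n<N mod ?m. ?f n)"
      using sum_periodic[of ?f ?m N, OF per] zero by simp
    also have "\<dots> \<le> (\<Sum>n<N mod ?m. real R * R)"
    proof (rule sum_mono)
      fix n
      have "?f n \<le> \<bar>\<Psi> S n\<bar> * \<bar>\<Psi> T n\<bar>" by (metis abs_ge_self abs_mult)
      also have "\<dots> \<le> real R * R" using \<Psi>abs S T by (intro mult_mono) auto
      finally show "?f n \<le> real R * R" .
    qed
    also have "\<dots> = real (N mod ?m) * (real R * R)" by simp
    also have "\<dots> \<le> real (R * R) * (real R * R)"
      using mR mpos mod_less_divisor[OF mpos, of N] by (intro mult_right_mono of_nat_mono) (linarith, simp)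
    also have "\<dots> = real R ^ 4" by (simp add: power4_eq_xxxx)
    finally show ?thesis .
  qed
  have FA: "F n = G" if "n \<in> A" for n
  proof -
    have "\<Psi> S n = 1" if "S \<in> D" for S
      unfolding \<Psi>_def using DD[OF that] \<open>n \<in> A\<close> by (intro prod.neutral) (auto simp: A_def \<psi>_def)
    then show ?thesis by (simp add: F_def GD)
  qed
  have "real (card A) * (G * G) = (\<Sum>n\<in>A. F n * F n)" using FA by simp
  also have "\<dots> \<le> (\<Sum>n<N. F n * F n)" by (rule sum_mono2) (auto simp: A_def)
  also have "\<dots> = (\<Sum>n<N. \<Sum>S\<in>D. \<Sum>T\<in>D. H S * H T * (\<Psi> S n * \<Psi> T n))"
    unfolding F_def sum_product by (simp add: mult_ac)
  also have "\<dots> = (\<Sum>S\<in>D. \<Sum>n<N. \<Sum>T\<in>D. H S * H T * (\<Psi> S n * \<Psi> T n))"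
    by (rule sum.swap)
  also have "\<dots> = (\<Sum>S\<in>D. \<Sum>T\<in>D. H S * H T * (\<Sum>n<N. \<Psi> S n * \<Psi> T n))"
    by (subst sum.swap) (simp add: sum_distrib_left)
  \<comment> \<open>The remainder is added on the diagonal as well, so that it sums to exactly G^2
    R^4.\<close>
  also have "\<dots> \<le> (\<Sum>S\<in>D. \<Sum>T\<in>D. (if S = T then (real N + R) * H S else 0) + H S * H T * real R ^ 4)"
  proof (intro sum_mono)
    fix S T assume S: "S \<in> D" and T: "T \<in> D"
    show "H S * H T * (\<Sum>n<N. \<Psi> S n * \<Psi> T n) \<le>
            (if S = T then (real N + R) * H S else 0) + H S * H T * real R ^ 4"
    proof (cases "S = T")
      case True
      have "H S * H S * (\<Sum>n<N. \<Psi> S n * \<Psi> S n) \<le> H S * H S * ((real N + R) / H S)"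
        using diag[OF S] Hpos[OF S] by (intro mult_left_mono) auto
      also have "\<dots> = (real N + R) * H S" using Hpos[OF S] by simp
      finally have "H S * H S * (\<Sum>n<N. \<Psi> S n * \<Psi> S n) \<le> (real N + R) * H S" .
      moreover have "H S * H S * real R ^ 4 \<ge> 0" by simp
      ultimately show ?thesis unfolding True[symmetric] if_P[OF refl] by linarith
    next
      case False
      then show ?thesis using off[OF S T] Hpos[OF S] Hpos[OF T] by (auto intro!: mult_left_mono)
    qed
  qed
  also have "\<dots> = (real N + R) * G + G * G * real R ^ 4"
  proof -
    have "(\<Sum>S\<in>D. \<Sum>T\<in>D. if S = T then (real N + R) * H S else 0) = (\<Sum>S\<in>D. (real N + R) * H S)"
      using finD by (intro sum.cong) auto
    moreover have "(\<Sum>S\<in>D. \<Sum>T\<in>D. H S * H T * real R ^ 4) = G * G * real R ^ 4"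
      unfolding GD sum_product by (simp only: sum_distrib_right)
    ultimately show ?thesis by (simp only: sum.distrib GD sum_distrib_left)
  qed
  also have "\<dots> = ((real N + real R) / G + real R ^ 4) * (G * G)"
    using Gpos by (simp add: field_simps)
  finally have "real (card A) \<le> (real N + real R) / G + real R ^ 4"
    using Gpos by (subst (asm) mult_le_cancel_right_pos) auto
  then show ?thesis by (simp add: A_def)
qed

section \<open>Lower bounds for the sieve density\<close>

lemma prime_sets_subset: "S \<in> prime_sets R \<Longrightarrow> T \<subseteq> S \<Longrightarrow> T \<in> prime_sets R"
proof -
  assume S: "S \<in> prime_sets R" and T: "T \<subseteq> S"
  have "\<Prod>T dvd \<Prod>S" using prime_setsD[OF S] T by (intro prod_dvd_prod_subset) auto
  then have "\<Prod>T \<le> \<Prod>S" using prime_setsD[OF S] by (intro dvd_imp_le) auto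
  then show "T \<in> prime_sets R"
    using prime_setsD[OF S] T finite_subset by (auto simp: prime_sets_def)
qed

lemma prime_sets_Un:
  assumes S: "S \<in> prime_sets X" and T: "T \<in> prime_sets Y"
  shows "S \<union> T \<in> prime_sets (X * Y)"
proof -
  have "\<Prod>(S \<union> T) = \<Prod>S * \<Prod>(T - S)"
    using prime_setsD[OF S] prime_setsD[OF T]
    by (subst prod.union_disjoint[symmetric]) auto
  also have "\<dots> \<le> X * Y"
    using prime_setsD[OF S] prime_setsD(3)[OF prime_sets_subset[OF T, of "T - S"]]
    by (intro mult_le_mono) auto
  finally show ?thesis using prime_setsD[OF S] prime_setsD[OF T] by (auto simp: prime_sets_def)
qed

lemma sum_inverse_squares_le: "(\<Sum>s=1..n. 1 / real s ^ 2) \<le> 2"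
proof -
  \<comment> \<open>The extra -1/n makes the induction close: 1/(n+1)^2 is at most 1/n -
    1/(n+1).\<close>
  have "(\<Sum>s=1..n. 1 / real s ^ 2) \<le> 2 - 1 / real n" if "n \<ge> 1" for n
    using that
  proof (induction n rule: nat_induct_at_least)
    case (Suc n)
    have "1 / real (Suc n) ^ 2 \<le> 1 / (real n * real (Suc n))"
      using Suc by (intro divide_left_mono) (auto simp: power2_eq_square)
    also have "\<dots> = 1 / real n - 1 / real (Suc n)" using Suc by (simp add: field_simps)
    finally show ?case using Suc by simp
  qed simp
  note * = this
  show ?thesis
  proof (cases "n \<ge> 1")
    case True
    then show ?thesis using *[OF True] by (intro order_trans[OF *[OF True]]) simp
  next
    case False
    then have "n = 0" by simp
    then show ?thesis by simp
  qed
qed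

text \<open>Every n up to \<open>Y\<close> is uniquely a squarefree number times a square, both
  parts bounded by \<open>Y\<close>. Hence the harmonic sum is at most the squarefree sum times the
  sum of 1/s^2, and the latter is at most 2.\<close>

lemma sum_prime_sets_inverse_ge:
  "ln (real Y + 1) / 2 \<le> (\<Sum>A\<in>prime_sets Y. \<Prod>p\<in>A. 1 / real p)"
proof -
  define \<phi> where "\<phi> n = (prime_factors (squarefree_part n), square_part n)" for n :: nat
  define g where "g A s = (\<Prod>p\<in>A. 1 / real p) * (1 / real s ^ 2)" for A :: "nat set" and s :: nat
  have sf: "\<Prod>(prime_factors (squarefree_part n)) = squarefree_part n" if "n > 0" for n :: nat
  proof -
    let ?m = "squarefree_part n"
    have m: "squarefree ?m" "?m \<noteq> 0" using that by (auto simp: squarefree_squarefree_part)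
    have "?m = (\<Prod>p\<in>prime_factors ?m. p ^ multiplicity p ?m)"
      by (metis m(2) gr0I prime_factorization_nat)
    also have "\<dots> = (\<Prod>p\<in>prime_factors ?m. p)"
      using m squarefree_factorial_semiring'[OF m(2)] by (intro prod.cong) auto
    finally show ?thesis by simp
  qed
  have decomp: "n = squarefree_part n * square_part n ^ 2" for n :: nat
    using squarefree_decompose[of n] by simp
  have eq: "1 / real n = (case \<phi> n of (A, s) \<Rightarrow> g A s)" if "n > 0" for n
  proof -
    have "1 / real n = 1 / real (squarefree_part n) * (1 / real (square_part n) ^ 2)"
      by (subst decomp) simp
    also have "1 / real (squarefree_part n) = (\<Prod>p\<in>prime_factors (squarefree_part n). 1 / real p)"
      by (subst sf[OF that, symmetric]) (simp add: prod_dividef)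
    finally show ?thesis by (simp add: \<phi>_def g_def)
  qed
  have inj: "inj_on \<phi> {1..Y}"
  proof (rule inj_onI)
    fix x y assume "x \<in> {1..Y}" "y \<in> {1..Y}" "\<phi> x = \<phi> y"
    then have "x > 0" "y > 0" "square_part x = square_part y"
      "prime_factors (squarefree_part x) = prime_factors (squarefree_part y)"
      by (auto simp: \<phi>_def)
    then show "x = y" by (metis sf decomp)
  qed
  have sub: "\<phi> ` {1..Y} \<subseteq> prime_sets Y \<times> {1..Y}"
  proof (rule image_subsetI)
    fix n assume n: "n \<in> {1..Y}"
    have "squarefree_part n dvd n" using decomp[of n] by (metis dvd_triv_left)
    then have "squarefree_part n \<le> n" using n by (intro dvd_imp_le) auto
    moreover have "square_part n dvd n"
      by (rule dvd_trans[OF _ square_part_square_dvd]) simp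
    then have "square_part n \<le> n" using n by (intro dvd_imp_le) auto
    moreover have "square_part n \<noteq> 0" using n by simp
    then have "square_part n \<ge> 1" by linarith
    ultimately show "\<phi> n \<in> prime_sets Y \<times> {1..Y}"
      unfolding \<phi>_def prime_sets_def using n sf[of n] by (auto dest: in_prime_factors_imp_prime)
  qed
  have g0: "g A s \<ge> 0" for A s by (simp add: g_def prod_nonneg)
  have "ln (real Y + 1) \<le> (\<Sum>n=1..Y. 1 / real n)"
    using harm_ge_ln[of Y] by (simp add: harm_def inverse_eq_divide)
  also have "\<dots> = (\<Sum>n=1..Y. case \<phi> n of (A, s) \<Rightarrow> g A s)"
    using eq by (intro sum.cong) auto
  also have "\<dots> = (\<Sum>(A, s)\<in>\<phi> ` {1..Y}. g A s)" by (subst sum.reindex[OF inj]) simp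
  also have "\<dots> \<le> (\<Sum>(A, s)\<in>prime_sets Y \<times> {1..Y}. g A s)"
    using sub g0 by (intro sum_mono2) auto
  also have "\<dots> = (\<Sum>A\<in>prime_sets Y. \<Prod>p\<in>A. 1 / real p) * (\<Sum>s=1..Y. 1 / real s ^ 2)"
    by (simp add: g_def sum_product sum.cartesian_product)
  also have "\<dots> \<le> (\<Sum>A\<in>prime_sets Y. \<Prod>p\<in>A. 1 / real p) * 2"
    by (intro mult_left_mono sum_inverse_squares_le sum_nonneg prod_nonneg) auto
  finally show ?thesis by simp
qed

lemma sum_prod_Pow:
  fixes f :: "'a \<Rightarrow> 'b :: comm_semiring_1"
  assumes "finite A"
  shows "(\<Sum>B\<in>Pow A. \<Prod>x\<in>B. f x) = (\<Prod>x\<in>A. 1 + f x)"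
  using prod_add[OF assms, of f "\<lambda>_. 1"] by (simp add: add.commute)

text \<open>A pair \<open>(A, B)\<close> with union \<open>T\<close> is encoded as \<open>(T, A, A \<inter> B)\<close>.\<close>

lemma sum_prime_sets_mult_le:
  fixes v w :: "nat \<Rightarrow> real"
  assumes v: "\<And>p. 0 \<le> v p" and w: "\<And>p. 0 \<le> w p"
  shows "(\<Sum>A\<in>prime_sets X. \<Prod>p\<in>A. v p) * (\<Sum>B\<in>prime_sets Y. \<Prod>p\<in>B. w p)
           \<le> (\<Sum>T\<in>prime_sets (X * Y). \<Prod>p\<in>T. v p + w p + v p * w p)"
proof -
  define \<phi> where "\<phi> = (\<lambda>(A, B). (A \<union> B, A, A \<inter> B :: nat set))"
  \<comment> \<open>Here \<open>B\<close> is recovered as the disjoint union of \<open>T - A\<close>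
    and \<open>C\<close>. For fixed \<open>T\<close>, a prime in \<open>A\<close> alone, in both
    sets, or in \<open>B\<close> alone contributes v, v w or w, which accounts for the factor v + w
    + v w.\<close>
  define g where "g = (\<lambda>(T, A, C). (\<Prod>p\<in>A. v p) * ((\<Prod>p\<in>T - A. w p) * (\<Prod>p\<in>C. w p)))"
  define \<Omega> where "\<Omega> = (SIGMA T:prime_sets (X * Y). SIGMA A:Pow T. Pow A)"
  have fin: "finite (Pow T)" if "T \<in> prime_sets n" for n T using prime_setsD[OF that] by simp
  have fin': "finite A" if "A \<in> Pow T" "T \<in> prime_sets n" for n A T
    using prime_setsD[OF that(2)] that(1) finite_subset by auto
  have "finite \<Omega>" unfolding \<Omega>_def using fin fin' by (intro finite_SigmaI) auto
  have "(\<Sum>A\<in>prime_sets X. \<Prod>p\<in>A. v p) * (\<Sum>B\<in>prime_sets Y. \<Prod>p\<in>B. w p)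
      = (\<Sum>(A, B)\<in>prime_sets X \<times> prime_sets Y. (\<Prod>p\<in>A. v p) * (\<Prod>p\<in>B. w p))"
    by (simp add: sum_product sum.cartesian_product)
  also have "\<dots> = (\<Sum>AB\<in>prime_sets X \<times> prime_sets Y. g (\<phi> AB))"
  proof (intro sum.cong refl, clarify)
    fix A B assume "A \<in> prime_sets X" "B \<in> prime_sets Y"
    then have "finite A" "finite B" using prime_setsD by auto
    then have "(\<Prod>p\<in>B. w p) = (\<Prod>p\<in>A \<union> B - A. w p) * (\<Prod>p\<in>A \<inter> B. w p)"
      by (subst prod.union_disjoint[symmetric]) (auto intro: prod.cong)
    then show "(\<Prod>p\<in>A. v p) * (\<Prod>p\<in>B. w p) = g (\<phi> (A, B))" by (simp add: g_def \<phi>_def)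
  qed
  also have "\<dots> = (\<Sum>x\<in>\<phi> ` (prime_sets X \<times> prime_sets Y). g x)"
  proof -
    have "inj_on \<phi> (prime_sets X \<times> prime_sets Y)" by (auto simp: inj_on_def \<phi>_def)
    then show ?thesis by (simp add: sum.reindex)
  qed
  also have "\<dots> \<le> (\<Sum>x\<in>\<Omega>. g x)"
  proof (rule sum_mono2[OF \<open>finite \<Omega>\<close>])
    show "\<phi> ` (prime_sets X \<times> prime_sets Y) \<subseteq> \<Omega>"
      using prime_sets_Un by (auto simp: \<phi>_def \<Omega>_def)
    show "0 \<le> g x" for x using v w by (auto simp: g_def prod_nonneg split: prod.split)
  qed
  also have "\<dots> = (\<Sum>T\<in>prime_sets (X * Y). \<Sum>A\<in>Pow T. \<Sum>C\<in>Pow A. g (T, A, C))"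
    unfolding \<Omega>_def
  proof -
    have "(\<Sum>T\<in>prime_sets (X * Y). \<Sum>A\<in>Pow T. \<Sum>C\<in>Pow A. g (T, A, C)) =
        (\<Sum>T\<in>prime_sets (X * Y). \<Sum>AC\<in>Sigma (Pow T) Pow. g (T, AC))"
      using fin fin' by (intro sum.cong refl, subst sum.Sigma) (auto simp: case_prod_unfold)
    also have "\<dots> = sum g (SIGMA T:prime_sets (X * Y). Sigma (Pow T) Pow)"
      using fin fin' by (subst sum.Sigma) (auto intro!: finite_SigmaI simp: case_prod_unfold)
    finally show "sum g (SIGMA T:prime_sets (X * Y). Sigma (Pow T) Pow) =
        (\<Sum>T\<in>prime_sets (X * Y). \<Sum>A\<in>Pow T. \<Sum>C\<in>Pow A. g (T, A, C))" by simp
  qed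
  also have "\<dots> = (\<Sum>T\<in>prime_sets (X * Y). \<Prod>p\<in>T. v p + w p + v p * w p)"
  proof (rule sum.cong[OF refl])
    fix T assume T: "T \<in> prime_sets (X * Y)"
    have "(\<Sum>A\<in>Pow T. \<Sum>C\<in>Pow A. g (T, A, C)) =
        (\<Sum>A\<in>Pow T. (\<Prod>p\<in>A. v p * (1 + w p)) * (\<Prod>p\<in>T - A. w p))"
    proof (rule sum.cong[OF refl])
      fix A assume A: "A \<in> Pow T"
      have "(\<Sum>C\<in>Pow A. g (T, A, C)) = (\<Prod>p\<in>A. v p) * ((\<Prod>p\<in>T - A. w p) * (\<Sum>C\<in>Pow A. \<Prod>p\<in>C. w p))"
        by (simp add: g_def sum_distrib_left)
      then show "(\<Sum>C\<in>Pow A. g (T, A, C)) = (\<Prod>p\<in>A. v p * (1 + w p)) * (\<Prod>p\<in>T - A. w p)"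
        using sum_prod_Pow[OF fin'[OF A T], of w] by (simp add: prod.distrib mult_ac)
    qed
    also have "\<dots> = (\<Prod>p\<in>T. v p * (1 + w p) + w p)"
      using prod_add[OF prime_setsD(1)[OF T]] by metis
    finally show "(\<Sum>A\<in>Pow T. \<Sum>C\<in>Pow A. g (T, A, C)) = (\<Prod>p\<in>T. v p + w p + v p * w p)"
      by (simp add: algebra_simps)
  qed
  finally show ?thesis .
qed

text \<open>Each \<open>B\<close> splits into its parts inside and outside \<open>H\<close>. The
  inner part is then allowed to be any subset of \<open>H\<close>, independently of the outer one,
  which produces the full product.\<close>

lemma sum_prime_sets_avoid:
  fixes w :: "nat \<Rightarrow> real"
  assumes w: "\<And>p. 0 \<le> w p" and H: "finite H"
  shows "(\<Sum>B\<in>prime_sets Y. \<Prod>p\<in>B. w p) \<le>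
     (\<Prod>p\<in>H. 1 + w p) * (\<Sum>B\<in>prime_sets Y. \<Prod>p\<in>B. if p \<in> H then 0 else w p)"
proof -
  define \<phi> where "\<phi> B = (B \<inter> H, B - H)" for B
  define g where "g = (\<lambda>(C, B). (\<Prod>p\<in>C. w p) * (\<Prod>p\<in>B. if p \<in> H then 0 else w p))"
  have "(\<Sum>B\<in>prime_sets Y. \<Prod>p\<in>B. w p) = (\<Sum>B\<in>prime_sets Y. g (\<phi> B))"
  proof (rule sum.cong[OF refl])
    fix B assume "B \<in> prime_sets Y"
    then have "finite B" using prime_setsD by auto
    then have "(\<Prod>p\<in>B. w p) = (\<Prod>p\<in>B \<inter> H. w p) * (\<Prod>p\<in>B - H. w p)"
      by (subst prod.union_disjoint[symmetric]) (auto intro: prod.cong)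
    also have "(\<Prod>p\<in>B - H. w p) = (\<Prod>p\<in>B - H. if p \<in> H then 0 else w p)"
      by (rule prod.cong) auto
    finally show "(\<Prod>p\<in>B. w p) = g (\<phi> B)" by (simp add: g_def \<phi>_def)
  qed
  also have "\<dots> = (\<Sum>x\<in>\<phi> ` prime_sets Y. g x)"
  proof -
    have "inj_on \<phi> (prime_sets Y)" by (auto simp: inj_on_def \<phi>_def)
    then show ?thesis by (simp add: sum.reindex)
  qed
  also have "\<dots> \<le> (\<Sum>x\<in>Pow H \<times> prime_sets Y. g x)"
  proof (rule sum_mono2)
    show "\<phi> ` prime_sets Y \<subseteq> Pow H \<times> prime_sets Y"
      by (auto simp: \<phi>_def intro: prime_sets_subset)
  qed (use H w in \<open>auto simp: g_def prod_nonneg\<close>)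
  also have "\<dots> = (\<Sum>C\<in>Pow H. \<Prod>p\<in>C. w p) * (\<Sum>B\<in>prime_sets Y. \<Prod>p\<in>B. if p \<in> H then 0 else w p)"
    by (simp add: g_def sum_product sum.cartesian_product)
  finally show ?thesis using sum_prod_Pow[OF H, of w] by simp
qed

text \<open>This \<open>h\<close> is the sieve density when one class is removed modulo primes in
  \<open>H\<close> and two modulo all others. It dominates v + w + v w for v = 1/p everywhere and w
  = 1/p off \<open>H\<close>, so the sum at level Y^2 is at least a product of two one-dimensional
  sums at level Y. Having 2 in \<open>H\<close> keeps 2 / (p - 2) away from its pole.\<close>

lemma two_dim_sum_ge:
  fixes h :: "nat \<Rightarrow> real"
  assumes H: "finite H" "2 \<in> H"
    and h: "\<And>p. h p = (if p \<in> H then 1 / (real p - 1) else 2 / (real p - 2))"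
  shows "(ln (real Y + 1) / 2)\<^sup>2 \<le>
    (\<Prod>p\<in>H. 1 + 1 / real p) * (\<Sum>S\<in>prime_sets (Y * Y). \<Prod>p\<in>S. h p)"
proof -
  let ?v = "\<lambda>p. 1 / real p" and ?w = "\<lambda>p. if p \<in> H then 0 else 1 / real p"
  let ?V = "\<Sum>A\<in>prime_sets Y. \<Prod>p\<in>A. ?v p" and ?W = "\<Sum>A\<in>prime_sets Y. \<Prod>p\<in>A. ?w p"
  have le: "?v p + ?w p + ?v p * ?w p \<le> h p" if "prime p" for p
  proof (cases "p \<in> H")
    case True
    then show ?thesis using prime_ge_2_nat[OF that] by (simp add: h field_simps)
  next
    case False
    then have "p \<noteq> 2" using H by auto
    then have "p \<ge> 3" using prime_ge_2_nat[OF that] by simp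
    then show ?thesis using False by (simp add: h field_simps)
  qed
  have V0: "?V \<ge> 0" by (intro sum_nonneg prod_nonneg) auto
  have "(ln (real Y + 1) / 2)\<^sup>2 \<le> ?V\<^sup>2"
    using sum_prime_sets_inverse_ge[of Y] by (intro power_mono) auto
  also have "\<dots> = ?V * ?V" by (simp add: power2_eq_square)
  also have "\<dots> \<le> ?V * ((\<Prod>p\<in>H. 1 + 1 / real p) * ?W)"
    using V0 sum_prime_sets_avoid[of ?v H Y] H by (intro mult_left_mono) auto
  also have "\<dots> = (\<Prod>p\<in>H. 1 + 1 / real p) * (?V * ?W)" by simp
  also have "\<dots> \<le> (\<Prod>p\<in>H. 1 + 1 / real p) *
      (\<Sum>S\<in>prime_sets (Y * Y). \<Prod>p\<in>S. ?v p + ?w p + ?v p * ?w p)"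
    by (intro mult_left_mono sum_prime_sets_mult_le prod_nonneg) auto
  also have "\<dots> \<le> (\<Prod>p\<in>H. 1 + 1 / real p) * (\<Sum>S\<in>prime_sets (Y * Y). \<Prod>p\<in>S. h p)"
    using le prime_setsD by (intro mult_left_mono sum_mono prod_mono prod_nonneg) auto
  finally show ?thesis .
qed

lemma one_dim_sum_ge:
  "ln (real R + 1) / 2 \<le> (\<Sum>S\<in>prime_sets R. \<Prod>p\<in>S. 1 / (real p - 1))"
proof -
  note sum_prime_sets_inverse_ge[of R]
  also have "(\<Sum>S\<in>prime_sets R. \<Prod>p\<in>S. 1 / real p) \<le> (\<Sum>S\<in>prime_sets R. \<Prod>p\<in>S. 1 / (real p - 1))"
  proof (intro sum_mono prod_mono)
    fix S p assume "S \<in> prime_sets R" "p \<in> S"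
    then have "p \<ge> 2" using prime_setsD prime_ge_2_nat by blast
    then show "0 \<le> 1 / real p \<and> 1 / real p \<le> 1 / (real p - 1)" by (auto simp: field_simps)
  qed
  finally show ?thesis .
qed

section \<open>Sieve bounds for primes and for prime pairs with a fixed difference\<close>

theorem card_primes_le:
  assumes "R > 0"
  shows "real (card {n. n < N \<and> prime n}) \<le>
     2 * (real N + real R) / ln (real R + 1) + real R ^ 4 + real R"
proof -
  let ?G = "\<Sum>S\<in>prime_sets R. \<Prod>p\<in>S. 1 / (real p - 1)"
  define A where "A = {n. n < N \<and> (\<forall>p. prime p \<longrightarrow> p \<le> R \<longrightarrow> n mod p \<notin> {0})}"
  have "real (card A) \<le> (real N + real R) / ?G + real R ^ 4"
    unfolding A_def
    by (rule selberg_sieve) (use assms in \<open>auto simp: prime_gt_0_nat prime_gt_Suc_0_nat\<close>)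
  also have "(real N + real R) / ?G \<le> (real N + real R) / (ln (real R + 1) / 2)"
  proof (rule divide_left_mono)
    have "ln (real R + 1) > 0" using assms by simp
    then show "0 < ?G * (ln (real R + 1) / 2)" using one_dim_sum_ge[of R] by (intro mult_pos_pos) linarith+
  qed (use one_dim_sum_ge in auto)
  finally have A: "real (card A) \<le> 2 * (real N + real R) / ln (real R + 1) + real R ^ 4"
    by (simp add: mult.commute)
  \<comment> \<open>A prime p at most \<open>R\<close> is itself removed by its class 0, so small
    primes are counted separately; they are the source of the last summand \<open>R\<close>.\<close>
  have "{n. n < N \<and> prime n} \<subseteq> A \<union> {1..R}"
  proof
    fix n assume n: "n \<in> {n. n < N \<and> prime n}"
    show "n \<in> A \<union> {1..R}"
    proof (cases "n \<le> R")
      case False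
      then have "\<not> p dvd n" if "prime p" "p \<le> R" for p
        using that n primes_dvd_imp_eq by blast
      then show ?thesis using n by (auto simp: A_def dvd_eq_mod_eq_0)
    qed (use n prime_gt_0_nat in \<open>force simp: Suc_le_eq\<close>)
  qed
  then have "card {n. n < N \<and> prime n} \<le> card (A \<union> {1..R})"
    by (intro card_mono) (auto simp: A_def)
  also have "\<dots> \<le> card A + R" using card_Un_le[of A "{1..R}"] by simp
  finally show ?thesis using A by linarith
qed

text \<open>The classes 0 and -k are removed modulo p. They coincide when p divides k, and for p = 2
  with k odd they would exhaust all residues; these primes form \<open>H\<close> and lose one class
  only, at the price of the product over \<open>H\<close>. The sieve level is Y^2, so its fourth
  power is the remainder Y^8.\<close>

theorem card_prime_pairs_le:
  assumes "Y > 0" "k > 0"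
  shows "real (card {n. n < N \<and> prime n \<and> prime (n + k)}) \<le>
     4 * (real N + real Y ^ 2) * (\<Prod>p\<in>insert 2 (prime_factors k). 1 + 1 / real p) / (ln (real Y + 1))\<^sup>2
       + real Y ^ 8 + real Y ^ 2"
proof -
  let ?R = "Y * Y"
  define H where "H = insert 2 (prime_factors k)"
  define h :: "nat \<Rightarrow> real" where "h p = (if p \<in> H then 1 / (real p - 1) else 2 / (real p - 2))" for p
  \<comment> \<open>Off \<open>H\<close> the prime p does not divide k, so p - k mod p is a least
    residue, nonzero and distinct from 0.\<close>
  define B where "B p = (if p \<in> H then {0} else {0, p - k mod p})" for p
  define G where "G = (\<Sum>S\<in>prime_sets ?R. \<Prod>p\<in>S. h p)"
  define A where "A = {n. n < N \<and> (\<forall>p. prime p \<longrightarrow> p \<le> ?R \<longrightarrow> n mod p \<notin> B p)}"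
  have ndvd: "k mod p > 0" "p > 2" if "prime p" "p \<notin> H" for p
  proof -
    have "\<not> p dvd k" "p \<noteq> 2" using that assms by (auto simp: H_def prime_factors_dvd)
    then show "k mod p > 0" "p > 2" using prime_ge_2_nat[OF that(1)] by (auto simp: dvd_eq_mod_eq_0)
  qed
  have cardB: "card (B p) = (if p \<in> H then 1 else 2)" if "prime p" for p
  proof (cases "p \<in> H")
    case False
    have "k mod p < p" using prime_gt_0_nat[OF that] by simp
    then show ?thesis using False by (simp add: B_def)
  qed (simp add: B_def)
  have "real (card A) \<le> (real N + real ?R) / G + real ?R ^ 4"
    unfolding A_def G_def
  proof (rule selberg_sieve)
    fix p :: nat assume p: "prime p"
    show "B p \<subseteq> {..<p}" using ndvd[OF p] prime_gt_0_nat[OF p] by (auto simp: B_def)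
    show "B p \<noteq> {}" by (simp add: B_def)
    show "card (B p) < p" using cardB[OF p] ndvd[OF p] prime_ge_2_nat[OF p] by auto
    show "h p = card (B p) / (real p - card (B p))" using cardB[OF p] by (simp add: h_def)
  qed (use assms in auto)
  also have "(real N + real ?R) / G \<le>
      4 * (real N + real Y ^ 2) * (\<Prod>p\<in>H. 1 + 1 / real p) / (ln (real Y + 1))\<^sup>2"
  proof -
    let ?P = "\<Prod>p\<in>H. 1 + 1 / real p"
    have *: "(ln (real Y + 1) / 2)\<^sup>2 \<le> ?P * G"
      unfolding G_def by (rule two_dim_sum_ge) (auto simp: H_def h_def)
    have P: "?P > 0" by (intro prod_pos) (auto intro: add_pos_nonneg)
    have l: "ln (real Y + 1) > 0" using assms by simp
    then have "0 < ?P * G" using * by (intro less_le_trans[OF _ *]) simp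
    then have G: "G > 0" using P by (simp add: zero_less_mult_iff)
    have "(real N + real ?R) / G = (real N + real ?R) * ?P / (?P * G)" using P by simp
    also have "\<dots> \<le> (real N + real ?R) * ?P / (ln (real Y + 1) / 2)\<^sup>2"
      using * P G l by (intro divide_left_mono mult_nonneg_nonneg mult_pos_pos) auto
    finally show ?thesis by (simp add: power2_eq_square field_simps)
  qed
  also have "real ?R ^ 4 = real Y ^ 8" by (simp add: power_mult_distrib flip: power_add)
  finally have A: "real (card A) \<le> 4 * (real N + real Y ^ 2) * (\<Prod>p\<in>H. 1 + 1 / real p) / (ln (real Y + 1))\<^sup>2 + real Y ^ 8"
    by simp
  have "{n. n < N \<and> prime n \<and> prime (n + k)} \<subseteq> A \<union> {1..?R}"
  proof
    fix n assume n: "n \<in> {n. n < N \<and> prime n \<and> prime (n + k)}"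
    show "n \<in> A \<union> {1..?R}"
    proof (cases "n \<le> ?R")
      case False
      have "n mod p \<notin> B p" if p: "prime p" "p \<le> ?R" for p
      proof
        assume B: "n mod p \<in> B p"
        have nd: "\<not> p dvd n" "\<not> p dvd n + k"
          using primes_dvd_imp_eq[OF p(1), of n] primes_dvd_imp_eq[OF p(1), of "n + k"] p n False by auto
        then have "p \<notin> H" "n mod p = p - k mod p" using B by (auto simp: B_def dvd_eq_mod_eq_0 split: if_splits)
        then have "n mod p + k mod p = p" using mod_less_divisor[of p k] prime_gt_0_nat[OF p(1)] by simp
        then have "(n + k) mod p = 0" by (metis mod_add_eq mod_self)
        with nd show False by auto
      qed
      then show ?thesis using n by (auto simp: A_def)
    qed (use n prime_gt_0_nat in \<open>force simp: Suc_le_eq\<close>)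
  qed
  then have "card {n. n < N \<and> prime n \<and> prime (n + k)} \<le> card (A \<union> {1..?R})"
    by (intro card_mono) (auto simp: A_def)
  also have "\<dots> \<le> card A + ?R" using card_Un_le[of A "{1..?R}"] by simp
  finally have "real (card {n. n < N \<and> prime n \<and> prime (n + k)}) \<le> real (card A + ?R)"
    by (rule of_nat_mono)
  then show ?thesis using A unfolding H_def by (simp add: power2_eq_square)
qed

section \<open>Chebyshev's lower bound\<close>

lemma finite_exponents_le:
  fixes p :: nat
  assumes "1 < p"
  shows "finite {e. p ^ e \<le> N}"
proof (rule finite_subset)
  show "{e. p ^ e \<le> N} \<subseteq> {..N}"
  proof
    fix e assume "e \<in> {e. p ^ e \<le> N}"
    then show "e \<in> {..N}" using power_gt_expt[of p e] assms by simp
  qed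
qed simp

text \<open>The product is lcm(1, ..., N): each prime power exactly dividing i is at most N, so its
  exponent is at most the maximal one.\<close>

lemma dvd_prod_max_prime_powers:
  fixes i N :: nat
  assumes "0 < i" "i \<le> N"
  shows "i dvd (\<Prod>p | prime p \<and> p \<le> N. p ^ Max {e. p ^ e \<le> N})"
    (is "_ dvd ?L")
proof -
  have "i = (\<Prod>p\<in>prime_factors i. p ^ multiplicity p i)"
    using assms by (simp add: prime_factorization_nat)
  also have "\<dots> dvd (\<Prod>p\<in>prime_factors i. p ^ Max {e. p ^ e \<le> N})"
  proof (rule prod_dvd_prod)
    fix p assume p: "p \<in> prime_factors i"
    then have "1 < p" using in_prime_factors_imp_prime prime_gt_1_nat by blast
    from p have "p ^ multiplicity p i \<le> N"
      using assms multiplicity_dvd[of p i] by (meson dvd_imp_le le_trans)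
    then show "p ^ multiplicity p i dvd p ^ Max {e. p ^ e \<le> N}"
      using \<open>1 < p\<close> by (intro le_imp_power_dvd Max_ge finite_exponents_le) auto
  qed
  also have "\<dots> dvd ?L"
  proof (rule prod_dvd_prod_subset)
    show "prime_factors i \<subseteq> {p. prime p \<and> p \<le> N}"
      using assms by (auto simp: prime_factors_dvd dest: dvd_imp_le)
  qed auto
  finally show ?thesis .
qed

text \<open>\<open>a! b! / (a + b + 1)!\<close> is the integral of \<open>x\<^sup>a (1 - x)\<^sup>b\<close> over \<open>[0, 1]\<close>; the induction is the
  identity \<open>x\<^sup>a (1 - x)\<^sup>b\<^sup>+\<^sup>1 = x\<^sup>a (1 - x)\<^sup>b - x\<^sup>a\<^sup>+\<^sup>1 (1 - x)\<^sup>b\<close>.\<close>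

lemma common_multiple_beta_Ints:
  fixes L :: nat
  assumes "\<And>i. 0 < i \<Longrightarrow> i \<le> N \<Longrightarrow> i dvd L" "a + b < N"
  shows "real L * (fact a * fact b / fact (a + b + 1)) \<in> \<int>"
  using assms(2)
proof (induction b arbitrary: a)
  case 0
  then obtain k where "L = (a + 1) * k" using assms(1)[of "a + 1"] by auto
  then have "real L = (real a + 1) * real k" by (simp add: algebra_simps)
  moreover have "fact (a + 0 + 1) = (real a + 1) * fact a" by simp
  moreover have "real a + 1 \<noteq> 0" by linarith
  ultimately have "real L * (fact a * fact 0 / fact (a + 0 + 1)) = of_nat k"
    by (simp only: fact_0 mult_1_right) simp
  then show ?case by (metis Ints_of_nat)
next
  case (Suc b)
  have "real L * (fact a * fact (Suc b) / fact (a + Suc b + 1)) =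
     real L * (fact a * fact b / fact (a + b + 1)) -
     real L * (fact (Suc a) * fact b / fact (Suc a + b + 1))"
    by (simp add: divide_simps) (simp add: algebra_simps)
  also have "\<dots> \<in> \<int>" using Suc.IH[of a] Suc.IH[of "Suc a"] Suc.prems by (intro Ints_diff) auto
  finally show ?case .
qed

text \<open>\<open>L\<close> times the integral of (x (1 - x))^m over [0, 1] is a positive integer,
  hence at least 1, while the integral is at most 4^(-m). The latter is proved on factorials:
  consecutive values have ratio at most 1/4.\<close>

lemma common_multiple_ge:
  fixes L :: nat
  assumes "\<And>i. 0 < i \<Longrightarrow> i \<le> 2 * m + 1 \<Longrightarrow> i dvd L" "L > 0"
  shows "4 ^ m \<le> real L"
proof -
  let ?b = "fact m * fact m / fact (m + m + 1) :: real"
  have Ints_ge_1: "x \<ge> 1" if "x \<in> \<int>" "x > 0" for x :: real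
    using that by (auto elim!: Ints_cases)
  have "real L * ?b \<in> \<int>"
    by (rule common_multiple_beta_Ints[where N = "2 * m + 1"]) (use assms in auto)
  moreover have "real L * ?b > 0" using assms by simp
  ultimately have "real L * ?b \<ge> 1" by (rule Ints_ge_1)
  moreover have "?b \<le> 1 / 4 ^ m"
  proof (induction m)
    case (Suc m)
    have "fact (Suc m) = (real m + 1) * fact m"
      "fact (Suc m + Suc m + 1) = (2 * real m + 2) * (2 * real m + 3) * fact (m + m + 1)"
      by (simp_all add: algebra_simps)
    moreover have "fact (m + m + 1) \<noteq> (0 :: real)" by simp
    ultimately have "fact (Suc m) * fact (Suc m) / fact (Suc m + Suc m + 1) =
      fact m * fact m / fact (m + m + 1) * ((real m + 1) * (real m + 1) / ((2 * real m + 2) * (2 * real m + 3)))"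
      by (simp only: times_divide_times_eq mult_ac)
    also have "\<dots> \<le> 1 / 4 ^ m * (1 / 4)"
    proof (rule mult_mono[OF Suc])
      show "(real m + 1) * (real m + 1) / ((2 * real m + 2) * (2 * real m + 3)) \<le> 1 / 4"
      proof -
        have "(2 * real m + 2) * (2 * real m + 3) > 0" by (intro mult_pos_pos) auto
        then show ?thesis by (simp only: pos_divide_le_eq) (simp add: algebra_simps)
      qed
    qed auto
    finally show ?case by simp
  qed simp
  then have "real L * ?b \<le> real L * (1 / 4 ^ m)" by (intro mult_left_mono) auto
  ultimately have "1 \<le> real L * (1 / 4 ^ m)" by linarith
  then show ?thesis by (simp add: field_simps)
qed

theorem chebyshev_lower:
  fixes N :: nat
  assumes "N \<ge> 5"
  shows "real N / 4 \<le> real (card {p. prime p \<and> p < N}) * ln N"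
proof -
  define M where "M = N - 1"
  \<comment> \<open>The largest m with 2 m + 1 at most N - 1; the cutoff is N - 1 because the primes
    counted are strictly below N.\<close>
  define m where "m = (N - 2) div 2"
  define Q where "Q = {p. prime p \<and> p \<le> M}"
  define L where "L = (\<Prod>p\<in>Q. p ^ Max {e. p ^ e \<le> M})"
  have Q: "Q = {p. prime p \<and> p < N}" using assms by (auto simp: Q_def M_def)
  have "4 ^ m \<le> real L"
  proof (rule common_multiple_ge)
    show "i dvd L" if "0 < i" "i \<le> 2 * m + 1" for i
      unfolding L_def Q_def using that assms
      by (intro dvd_prod_max_prime_powers) (auto simp: m_def M_def)
    show "L > 0" unfolding L_def by (intro prod_pos) (auto simp: Q_def prime_gt_0_nat)
  qed
  also have "L \<le> (\<Prod>p\<in>Q. N)"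
    unfolding L_def
  proof (rule prod_mono)
    fix p assume p: "p \<in> Q"
    have "finite {e. p ^ e \<le> M}"
      using p by (intro finite_exponents_le) (auto simp: Q_def dest: prime_gt_Suc_0_nat)
    moreover have "0 \<in> {e. p ^ e \<le> M}" using assms by (simp add: M_def)
    ultimately have "Max {e. p ^ e \<le> M} \<in> {e. p ^ e \<le> M}" by (intro Max_in) blast+
    then show "0 \<le> p ^ Max {e. p ^ e \<le> M} \<and> p ^ Max {e. p ^ e \<le> M} \<le> N"
      by (simp add: M_def)
  qed
  also have "(\<Prod>p\<in>Q. N) = N ^ card Q" by simp
  finally have "ln (4 ^ m) \<le> ln (real N ^ card Q)"
    using assms by (subst ln_le_cancel_iff) auto
  then have m_le: "real m * ln 4 \<le> real (card Q) * ln N" using assms by (simp add: ln_realpow)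
  \<comment> \<open>With ln 4 at least 4/3 and m at least (N - 3)/2 this gives 2 (N - 3) / 3, which
    reaches N/4 from N = 5 on.\<close>
  have "2 / 3 * (2 * real m) \<le> ln 2 * (2 * real m)"
    using ln2_ge_two_thirds by (intro mult_right_mono) auto
  also have "\<dots> = real m * ln 4" using ln_realpow[of 2 2] by simp
  also note m_le
  finally have "4 / 3 * real m \<le> real (card Q) * ln N" by simp
  moreover have "N \<le> 2 * m + 3" unfolding m_def using assms by linarith
  then have "real N \<le> 2 * real m + 3" by linarith
  ultimately show ?thesis using assms unfolding Q by linarith
qed

section \<open>Pairs of congruent primes\<close>

text \<open>Expanding the product over subsets of the prime factors gives the sum of 1/d over the
  squarefree divisors d only.\<close>

lemma prod_one_plus_inverse_le_sum_divisors:
  fixes k :: nat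
  assumes "k > 0"
  shows "(\<Prod>p\<in>prime_factors k. 1 + 1 / real p) \<le> (\<Sum>d | d dvd k. 1 / real d)"
proof -
  let ?P = "prime_factors k"
  have fin: "finite A" "\<And>p. p \<in> A \<Longrightarrow> prime p" if "A \<in> Pow ?P" for A
    using that finite_subset[of A ?P] by auto
  have inj: "inj_on Prod (Pow ?P)"
  proof (rule inj_onI)
    fix A B assume A: "A \<in> Pow ?P" and B: "B \<in> Pow ?P" and "\<Prod>A = \<Prod>B"
    have pf: "prime_factors (\<Prod>C) = C" if "C \<in> Pow ?P" for C
    proof -
      have "prime_factors (\<Prod>C) = \<Union>(prime_factors ` C)"
        using fin[OF that] by (subst prime_factors_prod) (auto simp: image_iff dest: prime_gt_0_nat)
      also have "\<dots> = C" using fin[OF that] by (auto simp: prime_prime_factors)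
      finally show ?thesis .
    qed
    show "A = B" using pf[OF A] pf[OF B] \<open>\<Prod>A = \<Prod>B\<close> by metis
  qed
  have "(\<Prod>p\<in>?P. 1 + 1 / real p) = (\<Sum>A\<in>Pow ?P. \<Prod>p\<in>A. 1 / real p)"
    by (rule sum_prod_Pow[symmetric]) simp
  also have "\<dots> = (\<Sum>A\<in>Pow ?P. 1 / real (\<Prod>A))" by (simp add: prod_dividef)
  also have "\<dots> = (\<Sum>d\<in>Prod ` Pow ?P. 1 / real d)" by (simp add: sum.reindex[OF inj])
  also have "\<dots> \<le> (\<Sum>d | d dvd k. 1 / real d)"
  proof (rule sum_mono2)
    show "Prod ` Pow ?P \<subseteq> {d. d dvd k}"
    proof clarify
      fix A assume A: "A \<subseteq> ?P"
      have "\<Prod>A dvd \<Prod>?P" using A by (intro prod_dvd_prod_subset) auto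
      also have "\<Prod>?P dvd (\<Prod>p\<in>?P. p ^ multiplicity p k)"
        by (intro prod_dvd_prod dvd_power) (auto simp: prime_factors_multiplicity)
      also have "\<dots> = k" by (rule prime_factorization_nat[OF assms, symmetric])
      finally show "\<Prod>A dvd k" .
    qed
  qed (use assms in auto)
  finally show ?thesis .
qed

text \<open>After interchanging summation, each d divides at most K/d of the k, which leaves K times
  the sum of 1/d^2.\<close>

lemma sum_prod_one_plus_inverse_le:
  "(\<Sum>k=1..K. \<Prod>p\<in>prime_factors k. 1 + 1 / real p) \<le> 2 * real K"
proof -
  have "(\<Sum>k=1..K. \<Prod>p\<in>prime_factors k. 1 + 1 / real p) \<le> (\<Sum>k=1..K. \<Sum>d | d dvd k. 1 / real d)"
    by (intro sum_mono prod_one_plus_inverse_le_sum_divisors) auto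
  also have "\<dots> = (\<Sum>k=1..K. \<Sum>d\<in>{d\<in>{1..K}. d dvd k}. 1 / real d)"
  proof (intro sum.cong refl)
    fix k assume "k \<in> {1..K}"
    then show "{d. d dvd k} = {d\<in>{1..K}. d dvd k}" by (auto dest: dvd_imp_le intro: Suc_leI dvd_pos_nat)
  qed
  also have "\<dots> = (\<Sum>d=1..K. \<Sum>k\<in>{k\<in>{1..K}. d dvd k}. 1 / real d)"
    by (rule sum.swap_restrict) auto
  also have "\<dots> \<le> (\<Sum>d=1..K. real K * (1 / real d ^ 2))"
  proof (rule sum_mono)
    fix d assume d: "d \<in> {1..K}"
    have "{k\<in>{1..K}. d dvd k} \<subseteq> (\<lambda>j. d * j) ` {1..K div d}"
    proof
      fix k assume "k \<in> {k\<in>{1..K}. d dvd k}"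
      then obtain j where j: "k = d * j" "1 \<le> k" "k \<le> K" by auto
      then have "j \<le> K div d" using d by (simp add: less_eq_div_iff_mult_less_eq mult.commute)
      then show "k \<in> (\<lambda>j. d * j) ` {1..K div d}" using j by (intro image_eqI[of _ _ j]) (cases j; simp)+
    qed
    then have "card {k\<in>{1..K}. d dvd k} \<le> card ((\<lambda>j. d * j) ` {1..K div d})"
      by (intro card_mono) auto
    also have "\<dots> \<le> K div d" using card_image_le[of "{1..K div d}"] by simp
    finally have "real (card {k\<in>{1..K}. d dvd k}) \<le> real (K div d)" by (rule of_nat_mono)
    also have "\<dots> \<le> real K / real d" by (rule of_nat_div_le_of_nat)
    finally have "real (card {k\<in>{1..K}. d dvd k}) * (1 / real d) \<le> real K / real d * (1 / real d)"
      by (intro mult_right_mono) auto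
    then show "(\<Sum>k\<in>{k\<in>{1..K}. d dvd k}. 1 / real d) \<le> real K * (1 / real d ^ 2)"
      by (simp add: power2_eq_square)
  qed
  also have "\<dots> = real K * (\<Sum>d=1..K. 1 / real d ^ 2)" by (simp add: sum_distrib_left)
  also have "\<dots> \<le> real K * 2" by (intro mult_left_mono sum_inverse_squares_le) auto
  finally show ?thesis by simp
qed

text \<open>Follows from (1 + 1/p)(1 - 1/p) <= 1, since the product of the 1 - 1/p is
  \<phi>(q)/q.\<close>

lemma prod_one_plus_inverse_le_totient:
  assumes "q > 0"
  shows "(\<Prod>p\<in>prime_factors q. 1 + 1 / real p) \<le> real q / real (totient q)"
proof -
  let ?P = "\<Prod>p\<in>prime_factors q. 1 + 1 / real p"
  have "?P * (\<Prod>p\<in>prime_factors q. 1 - 1 / real p) = (\<Prod>p\<in>prime_factors q. 1 - (1 / real p)\<^sup>2)"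
    unfolding prod.distrib[symmetric] by (simp add: algebra_simps power2_eq_square)
  also have "\<dots> \<le> 1"
  proof (rule prod_le_1)
    fix p assume "p \<in> prime_factors q"
    then have "p \<ge> 1" using prime_ge_1_nat by blast
    then show "0 \<le> 1 - (1 / real p)\<^sup>2 \<and> 1 - (1 / real p)\<^sup>2 \<le> 1" by (simp add: power_le_one)
  qed
  finally have "real q * (?P * (\<Prod>p\<in>prime_factors q. 1 - 1 / real p)) \<le> real q * 1"
    by (rule mult_left_mono) simp
  then have "?P * real (totient q) \<le> real q" by (simp add: totient_formula2 mult_ac)
  then show ?thesis using assms by (simp add: pos_le_divide_eq)
qed

text \<open>The extremal set is {2, ..., n + 1}, where the product telescopes to 1/(n + 1). In the
  induction the largest element is at least two more than the number of the others.\<close>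

lemma prod_one_minus_inverse_ge:
  fixes A :: "nat set"
  assumes "finite A" "\<And>a. a \<in> A \<Longrightarrow> a \<ge> 2"
  shows "1 / (real (card A) + 1) \<le> (\<Prod>a\<in>A. 1 - 1 / real a)"
  using assms
proof (induction A rule: finite_linorder_max_induct)
  case (insert b A)
  have "A \<subseteq> {2..<b}" using insert by force
  then have "card A \<le> b - 2" using card_mono[of "{2..<b}" A] by simp
  then have b: "real b \<ge> real (card A) + 2" using insert.prems[OF insertI1] by linarith
  have nb: "b \<notin> A" using insert by auto
  have "1 / (real (card (insert b A)) + 1) = (1 - 1 / (real (card A) + 2)) * (1 / (real (card A) + 1))"
    using insert.hyps nb by (simp add: divide_simps) (simp add: algebra_simps)
  also have "\<dots> \<le> (1 - 1 / real b) * (\<Prod>a\<in>A. 1 - 1 / real a)"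
  proof (rule mult_mono)
    show "1 - 1 / (real (card A) + 2) \<le> 1 - 1 / real b"
      using b by (intro diff_left_mono divide_left_mono) auto
    show "1 / (real (card A) + 1) \<le> (\<Prod>a\<in>A. 1 - 1 / real a)" using insert by simp
    show "0 \<le> 1 - 1 / real b" using insert.prems[of b] by simp
  qed auto
  finally show ?case using insert nb by simp
qed simp

text \<open>The product of the distinct primes dividing q is at least 2 to their number, so there
  are at most log_2 q of them. This crude bound suffices to let \<phi>(q) absorb error terms that
  are smaller powers of q.\<close>

lemma totient_ge:
  assumes "q > 0"
  shows "real q / (log 2 (real q) + 1) \<le> real (totient q)"
proof -
  let ?P = "prime_factors q"
  have "2 ^ card ?P \<le> (\<Prod>p\<in>?P. p)"
    unfolding prod_constant[symmetric] by (intro prod_mono) (simp add: in_prime_factors_imp_prime prime_ge_2_nat)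
  also have "\<dots> dvd (\<Prod>p\<in>?P. p ^ multiplicity p q)"
    by (intro prod_dvd_prod dvd_power) (auto simp: prime_factors_multiplicity)
  then have "(\<Prod>p\<in>?P. p) \<le> q" using assms
    by (intro dvd_imp_le) (simp_all flip: prime_factorization_nat)
  finally have "2 ^ card ?P \<le> real q" using of_nat_mono by fastforce
  then have "real (card ?P) \<le> log 2 (real q)" using assms by (simp add: le_log_iff powr_realpow)
  then have "real q / (log 2 (real q) + 1) \<le> real q / (real (card ?P) + 1)"
    using assms by (intro divide_left_mono mult_pos_pos) auto
  also have "\<dots> = real q * (1 / (real (card ?P) + 1))" by simp
  also have "\<dots> \<le> real q * (\<Prod>p\<in>?P. 1 - 1 / real p)"
    by (intro mult_left_mono prod_one_minus_inverse_ge)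
      (simp_all add: in_prime_factors_imp_prime prime_ge_2_nat)
  also have "\<dots> = real (totient q)" by (simp add: totient_formula2)
  finally show ?thesis .
qed

text \<open>The sizes of the fibres add up to \<open>card Q\<close>, and their squares to the number
  of ordered colliding pairs.\<close>

lemma card_square_le_collisions:
  fixes f :: "'a \<Rightarrow> 'b"
  assumes Q: "finite Q"
  shows "(card Q)\<^sup>2 \<le> card (f ` Q) * card {(x, y) \<in> Q \<times> Q. f x = f y}"
proof -
  define F where "F a = {x \<in> Q. f x = a}" for a
  have fin: "finite (F a)" for a using Q by (simp add: F_def)
  have "card Q = (\<Sum>a\<in>f ` Q. card (F a))"
    using Q by (subst card_UN_disjoint[symmetric]) (auto simp: F_def intro: arg_cong[of _ _ card])
  then have "(real (card Q))\<^sup>2 = (\<Sum>a\<in>f ` Q. 1 * real (card (F a)))\<^sup>2" by simp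
  also have "\<dots> \<le> (\<Sum>a\<in>f ` Q. 1\<^sup>2) * (\<Sum>a\<in>f ` Q. (real (card (F a)))\<^sup>2)"
    by (rule Cauchy_Schwarz_ineq_sum)
  also have "\<dots> = real (card (f ` Q) * (\<Sum>a\<in>f ` Q. card (F a \<times> F a)))"
    using fin by (simp add: card_cartesian_product power2_eq_square)
  also have "(\<Sum>a\<in>f ` Q. card (F a \<times> F a)) = card (\<Union>a\<in>f ` Q. F a \<times> F a)"
    using Q fin by (subst card_UN_disjoint) (auto simp: F_def)
  also have "(\<Union>a\<in>f ` Q. F a \<times> F a) = {(x, y) \<in> Q \<times> Q. f x = f y}" by (auto simp: F_def)
  finally show ?thesis by (simp flip: of_nat_power of_nat_mult)
qed

text \<open>Off the diagonal the larger prime exceeds the smaller by k q with 1 <= k <= N/q; the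
  factor 2 accounts for the two orders.\<close>

lemma card_cong_pairs_le:
  assumes "q > 0"
  shows "card {(x, y) \<in> {n. n < N \<and> prime n} \<times> {n. n < N \<and> prime n}. x mod q = y mod q} \<le>
     card {n :: nat. n < N \<and> prime n} +
     2 * (\<Sum>k=1..N div q. card {n. n < N \<and> prime n \<and> prime (n + k * q)})"
proof -
  define Q where "Q = {n :: nat. n < N \<and> prime n}"
  define D where "D = (\<lambda>x. (x, x)) ` Q"
  define U where "U = (SIGMA k:{1..N div q}. {n. n < N \<and> prime n \<and> prime (n + k * q)})"
  define L where "L = (\<lambda>(k, n). (n, n + k * q)) ` U"
  define L' where "L' = (\<lambda>(k, n). (n + k * q, n)) ` U"
  have finU: "finite U" unfolding U_def by (intro finite_SigmaI) auto
  have le: "\<exists>k. (k, x) \<in> U \<and> y = x + k * q"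
    if "x \<in> Q" "y \<in> Q" "x mod q = y mod q" "x < y" for x y
  proof -
    have "q dvd y - x" using that mod_eq_dvd_iff_nat[of x y q] by simp
    then obtain k where k: "y - x = q * k" by blast
    then have y: "y = x + k * q" using that by (simp add: algebra_simps)
    have "k \<ge> 1" using y that by (cases k) auto
    moreover have "k * q \<le> N" using y that by (simp add: Q_def)
    then have "k \<le> N div q" using assms by (simp add: less_eq_div_iff_mult_less_eq)
    ultimately show ?thesis using y that by (auto simp: U_def Q_def)
  qed
  have "{(x, y) \<in> Q \<times> Q. x mod q = y mod q} \<subseteq> D \<union> (L \<union> L')"
  proof
    fix z assume "z \<in> {(x, y) \<in> Q \<times> Q. x mod q = y mod q}"
    then obtain x y where z: "z = (x, y)" and xy: "x \<in> Q" "y \<in> Q" "x mod q = y mod q" by auto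
    consider "x = y" | "x < y" | "y < x" by linarith
    then show "z \<in> D \<union> (L \<union> L')"
    proof cases
      case 1
      then show ?thesis using z xy by (auto simp: D_def)
    next
      case 2
      then show ?thesis using le[of x y] z xy by (force simp: L_def)
    next
      case 3
      then show ?thesis using le[of y x] z xy by (force simp: L'_def)
    qed
  qed
  then have "card {(x, y) \<in> Q \<times> Q. x mod q = y mod q} \<le> card (D \<union> (L \<union> L'))"
    using finU by (intro card_mono) (auto simp: D_def L_def L'_def Q_def)
  also have "\<dots> \<le> card D + (card L + card L')"
    by (meson add_left_mono card_Un_le order_trans)
  also have "\<dots> \<le> card Q + (card U + card U)"
    unfolding D_def L_def L'_def using finU by (intro add_mono card_image_le) (auto simp: Q_def)
  also have "card U = (\<Sum>k=1..N div q. card {n. n < N \<and> prime n \<and> prime (n + k * q)})"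
    unfolding U_def by (subst card_SigmaI) auto
  finally show ?thesis by (simp add: Q_def)
qed

text \<open>The product attached to k q is at most (3/2) s(k) s(q), with 3/2 from the prime 2.
  Averaging s(k) over N/q shifts costs a factor 2, and the q in s(q) <= q/\<phi>(q) cancels the q in
  N/q. Since Y^2 <= N, the constant is 4 * 2 * (3/2) * 2 = 24.\<close>

lemma sum_card_prime_pairs_le:
  assumes "Y > 0" "q > 0" "Y ^ 2 \<le> N"
  shows "real (\<Sum>k=1..N div q. card {n. n < N \<and> prime n \<and> prime (n + k * q)}) \<le>
     24 * (real N)\<^sup>2 / (real (totient q) * (ln (real Y + 1))\<^sup>2) + real N / real q * (2 * real Y ^ 8)"
proof -
  define s where "s n = (\<Prod>p\<in>prime_factors n. 1 + 1 / real p)" for n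
  define l where "l = (ln (real Y + 1))\<^sup>2"
  have l: "l > 0" using assms by (simp add: l_def)
  have s0: "s n \<ge> 0" for n unfolding s_def by (intro prod_nonneg) auto
  have Y28: "real Y ^ 2 \<le> real Y ^ 8" using assms by (intro power_increasing) auto
  have YN: "real Y ^ 2 \<le> real N" using assms(3) by (metis of_nat_le_iff of_nat_power)
  have prod_union_le: "(\<Prod>p\<in>A \<union> B. 1 + 1 / real p) \<le> (\<Prod>p\<in>A. 1 + 1 / real p) * (\<Prod>p\<in>B. 1 + 1 / real p)"
    if "finite A" "finite B" for A B :: "nat set"
  proof -
    have "(\<Prod>p\<in>A \<union> B. 1 + 1 / real p) * 1 \<le> (\<Prod>p\<in>A \<union> B. 1 + 1 / real p) * (\<Prod>p\<in>A \<inter> B. 1 + 1 / real p)"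
      by (intro mult_left_mono prod_ge_1 prod_nonneg) auto
    then show ?thesis using prod.union_inter[OF that, of "\<lambda>p. 1 + 1 / real p"] by simp
  qed
  have one: "real (card {n. n < N \<and> prime n \<and> prime (n + k * q)}) \<le>
     12 * real N * s q / l * s k + 2 * real Y ^ 8" if "k > 0" for k
  proof -
    let ?P = "\<Prod>p\<in>insert 2 (prime_factors (k * q)). 1 + 1 / real p"
    have "insert 2 (prime_factors (k * q)) = {2} \<union> (prime_factors k \<union> prime_factors q)"
      using that assms by (simp add: prime_factors_product)
    then have "?P \<le> (\<Prod>p\<in>{2}. 1 + 1 / real p) * (\<Prod>p\<in>prime_factors k \<union> prime_factors q. 1 + 1 / real p)"
      using prod_union_le[of "{2}" "prime_factors k \<union> prime_factors q"] by simp
    also have "\<dots> \<le> (\<Prod>p\<in>{2}. 1 + 1 / real p) * (s k * s q)"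
      unfolding s_def by (intro mult_left_mono prod_union_le) auto
    finally have P: "?P \<le> 3 / 2 * (s k * s q)" by simp
    have "4 * (real N + real Y ^ 2) * ?P / l \<le> 4 * (2 * real N) * (3 / 2 * (s k * s q)) / l"
      using l YN P by (intro divide_right_mono mult_mono prod_nonneg) auto
    also have "\<dots> = 12 * real N * s q / l * s k" by simp
    finally show ?thesis
      using card_prime_pairs_le[of Y "k * q" N, OF assms(1) mult_pos_pos[OF that assms(2)]] Y28
      unfolding l_def by linarith
  qed
  have K: "real (N div q) \<le> real N / real q" by (rule of_nat_div_le_of_nat)
  have "real (\<Sum>k=1..N div q. card {n. n < N \<and> prime n \<and> prime (n + k * q)}) \<le>
      (\<Sum>k=1..N div q. 12 * real N * s q / l * s k + 2 * real Y ^ 8)"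
    unfolding of_nat_sum by (intro sum_mono one) auto
  also have "\<dots> = 12 * real N * s q / l * (\<Sum>k=1..N div q. s k) + real (N div q) * (2 * real Y ^ 8)"
    by (simp add: sum.distrib sum_distrib_left)
  also have "\<dots> \<le> 12 * real N * (real q / real (totient q)) / l * (2 * (real N / real q)) + real N / real q * (2 * real Y ^ 8)"
  proof (intro add_mono mult_mono divide_right_mono K)
    show "s q \<le> real q / real (totient q)"
      unfolding s_def using assms by (intro prod_one_plus_inverse_le_totient) auto
    show "(\<Sum>k=1..N div q. s k) \<le> 2 * (real N / real q)"
      using sum_prod_one_plus_inverse_le[of "N div q"] K unfolding s_def by linarith
  qed (use s0 l in \<open>auto intro!: sum_nonneg\<close>)
  also have "12 * real N * (real q / real (totient q)) / l * (2 * (real N / real q)) =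
      24 * (real N)\<^sup>2 / (real (totient q) * l)"
    using assms l by (simp add: power2_eq_square)
  finally show ?thesis unfolding l_def .
qed

lemma prime_residue_count_eq:
  assumes "q > 0"
  shows "prime_residue_count X q = card ((\<lambda>p. p mod q) ` {p. p < nat \<lceil>X\<rceil> \<and> prime p})"
proof -
  \<comment> \<open>The inequality is strict, so the ceiling is the right cutoff even for integral
    X; for X <= 0 it truncates to 0 and no p qualifies.\<close>
  have lt: "p < nat \<lceil>X\<rceil> \<longleftrightarrow> real p < X" for p by linarith
  then have "{a \<in> {0..<q}. \<exists>p::nat. prime p \<and> real p < X \<and> [p = a] (mod q)} =
      (\<lambda>p. p mod q) ` {p. p < nat \<lceil>X\<rceil> \<and> prime p}"
  proof (intro equalityI subsetI)
    fix a assume "a \<in> {a \<in> {0..<q}. \<exists>p::nat. prime p \<and> real p < X \<and> [p = a] (mod q)}"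
    then obtain p where p: "a < q" "prime p" "real p < X" "[p = a] (mod q)" by auto
    then have "a = p mod q" by (simp add: unique_euclidean_semiring_class.cong_def)
    then show "a \<in> (\<lambda>p. p mod q) ` {p. p < nat \<lceil>X\<rceil> \<and> prime p}" using p lt by blast
  next
    fix a assume "a \<in> (\<lambda>p. p mod q) ` {p. p < nat \<lceil>X\<rceil> \<and> prime p}"
    then obtain p where "prime p" "real p < X" "a = p mod q" using lt by blast
    moreover have "p mod q < q" "[p = p mod q] (mod q)"
      using assms by (simp_all add: unique_euclidean_semiring_class.cong_def)
    ultimately show "a \<in> {a \<in> {0..<q}. \<exists>p::nat. prime p \<and> real p < X \<and> [p = a] (mod q)}"
      by auto
  qed
  then show ?thesis by (simp add: prime_residue_count_def)
qed

section \<open>Counting residue classes\<close>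

text \<open>Used for sieve levels that are rounded powers of q; the + 1 inside the logarithm absorbs
  the rounding.\<close>

lemma nat_floor_powr_bounds:
  fixes x a :: real
  assumes "x \<ge> 1" "a > 0"
  defines "Y \<equiv> nat \<lfloor>x powr a\<rfloor>"
  shows "Y > 0" "a * ln x \<le> ln (real Y + 1)" "real Y ^ n \<le> x powr (a * real n)"
proof -
  have x: "x powr a \<ge> 1" using assms by (simp add: ge_one_powr_ge_zero)
  then have Y: "real Y \<le> x powr a" "x powr a \<le> real Y + 1" unfolding Y_def by linarith+
  show "Y > 0" using x unfolding Y_def by linarith
  have "a * ln x = ln (x powr a)" using assms by (simp add: ln_powr)
  also have "\<dots> \<le> ln (real Y + 1)" using x Y by (subst ln_le_cancel_iff) linarith+
  finally show "a * ln x \<le> ln (real Y + 1)" .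
  have "real Y ^ n \<le> (x powr a) ^ n" using Y by (intro power_mono) auto
  also have "\<dots> = x powr (a * real n)" using x assms by (simp add: powr_powr flip: powr_realpow)
  finally show "real Y ^ n \<le> x powr (a * real n)" .
qed

lemma prime_residue_count_lower:
  assumes "lam > 0"
  obtains c where "c > 0" "\<forall>\<^sub>F q in sequentially. \<forall>X \<ge> lam * real (totient q) * ln (real q).
      real (prime_residue_count X q) \<ge> c * real (totient q)"
proof
  \<comment> \<open>Chebyshev's 1/4 and ln N <= 2 ln q give at least a \<phi>(q) primes. In
    \<open>s\<close>, 98304 = 24 * 2^2 * 32^2 comes from the pair bound, N <= 2 \<open>X0\<close>
    and the exponent 1/32; the + 1 absorbs the remainder. With P primes, Cauchy-Schwarz gives at
    least P^2 / (P + 2 s \<phi>(q)) classes, whose value at P = a \<phi>(q) supplies the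
    constant.\<close>
  define a where "a = lam / 8"
  define s where "s = 98304 * lam\<^sup>2 + 1"
  have a: "a > 0" and s: "s > 0" using assms by (auto simp: a_def s_def intro: add_nonneg_pos)
  show "a\<^sup>2 / (a + 2 * s) > 0" using a s by (intro divide_pos_pos) auto
  \<comment> \<open>Beyond q >= 2, the conditions serve in turn to put the sieve remainder below
    \<phi>(q), to make Chebyshev's bound applicable, to ensure Y^2 <= N, and to ensure N <=
    q^2.\<close>
  have "\<forall>\<^sub>F q::nat in sequentially. real q \<ge> 2"
    and "\<forall>\<^sub>F q::nat in sequentially. 4 * lam * ln (real q) * real q powr (1 / 4) \<le> real q / (log 2 (real q) + 1)"
    and "\<forall>\<^sub>F q::nat in sequentially. 5 \<le> lam * (real q / (log 2 (real q) + 1)) * ln (real q)"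
    and "\<forall>\<^sub>F q::nat in sequentially. real q powr (1 / 16) \<le> lam * (real q / (log 2 (real q) + 1)) * ln (real q)"
    and "\<forall>\<^sub>F q::nat in sequentially. 2 * (lam * real q * ln (real q)) \<le> real q ^ 2"
    using assms by real_asymp+
  then show "\<forall>\<^sub>F q in sequentially. \<forall>X \<ge> lam * real (totient q) * ln (real q).
      real (prime_residue_count X q) \<ge> a\<^sup>2 / (a + 2 * s) * real (totient q)"
  proof eventually_elim
    case (elim q)
    define x where "x = real q"
    define \<phi> where "\<phi> = real (totient q)"
    define X0 where "X0 = lam * \<phi> * ln x"
    define N where "N = nat \<lceil>X0\<rceil>"
    \<comment> \<open>The exponent keeps the remainder Y^8 below q^(1/4) and the level Y^2 below
      q^(1/16).\<close>
    define Y where "Y = nat \<lfloor>x powr (1 / 32)\<rfloor>"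
    define Q where "Q = {p. p < N \<and> prime p}"
    define S where "S = (\<Sum>k=1..N div q. card {n. n < N \<and> prime n \<and> prime (n + k * q)})"
    define A where "A = card ((\<lambda>p. p mod q) ` Q)"
    have q: "q > 0" "x \<ge> 2" using elim by (auto simp: x_def)
    have lx: "ln x > 0" using q by simp
    have \<phi>: "\<phi> > 0" "\<phi> \<le> x" using q by (auto simp: \<phi>_def x_def totient_le)
    have tot: "x / (log 2 x + 1) \<le> \<phi>" using totient_ge[OF q(1)] by (simp add: x_def \<phi>_def)
    have "lam * (x / (log 2 x + 1)) * ln x \<le> X0"
      unfolding X0_def using tot assms lx by (intro mult_right_mono mult_left_mono) auto
    then have X0: "5 \<le> X0" "x powr (1 / 16) \<le> X0" using elim by (auto simp: x_def)
    have N: "N \<ge> 5" "X0 \<le> real N" "real N \<le> 2 * X0" using X0(1) unfolding N_def by linarith+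
    have Y: "Y > 0" "ln x / 32 \<le> ln (real Y + 1)"
      using nat_floor_powr_bounds(1,2)[of x "1 / 32"] q by (auto simp: Y_def)
    have "real Y ^ 2 \<le> real N"
      using nat_floor_powr_bounds(3)[of x "1 / 32" 2] q X0 N by (simp add: Y_def)
    then have YN: "Y ^ 2 \<le> N" by (metis of_nat_le_iff of_nat_power)
    have Y8: "real Y ^ 8 \<le> x powr (1 / 4)"
      using nat_floor_powr_bounds(3)[of x "1 / 32" 8] q by (simp add: Y_def)
    have "real N \<le> 2 * (lam * x * ln x)"
    proof -
      have "lam * \<phi> * ln x \<le> lam * x * ln x"
        using \<phi> assms lx by (intro mult_right_mono mult_left_mono) auto
      then show ?thesis using N by (simp add: X0_def)
    qed
    then have "real N \<le> x ^ 2" using elim(5) unfolding x_def by linarith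
    then have "ln (real N) \<le> ln (x ^ 2)" using N q by (subst ln_le_cancel_iff) auto
    then have lN: "ln (real N) \<le> 2 * ln x" using q by (simp add: ln_realpow)
    have "S \<le> 24 * (real N)\<^sup>2 / (\<phi> * (ln (real Y + 1))\<^sup>2) + real N / x * (2 * real Y ^ 8)"
      using sum_card_prime_pairs_le[OF Y(1) q(1) YN] by (simp add: S_def \<phi>_def x_def)
    also have "24 * (real N)\<^sup>2 / (\<phi> * (ln (real Y + 1))\<^sup>2) \<le> 24 * (2 * X0)\<^sup>2 / (\<phi> * (ln x / 32)\<^sup>2)"
      using N Y lx \<phi> by (intro frac_le mult_mono power_mono mult_pos_pos) auto
    also have "\<dots> = 98304 * lam\<^sup>2 * \<phi>"
      using lx \<phi> by (simp add: X0_def field_simps power2_eq_square)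
    also have "real N / x * (2 * real Y ^ 8) \<le> (2 * X0) / x * (2 * x powr (1 / 4))"
      using N Y8 q by (intro mult_mono divide_right_mono) auto
    also have "\<dots> = (4 * lam * ln x * x powr (1 / 4)) * (\<phi> / x)" by (simp add: X0_def)
    also have "\<dots> \<le> (4 * lam * ln x * x powr (1 / 4)) * 1"
      using assms lx \<phi> q by (intro mult_left_mono) auto
    also have "\<dots> \<le> \<phi>" using elim tot by (simp add: x_def)
    finally have S: "real S \<le> s * \<phi>" by (simp add: s_def algebra_simps)
    have "a * \<phi> = X0 / 4 / (2 * ln x)" using lx by (simp add: a_def X0_def)
    also have "\<dots> \<le> real N / 4 / ln (real N)" using N lN by (intro frac_le) auto
    also have "\<dots> \<le> real (card Q)"
      using chebyshev_lower[OF N(1)] N by (simp add: Q_def pos_divide_le_eq conj_commute)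
    finally have P: "a * \<phi> \<le> real (card Q)" .
    have "(card Q)\<^sup>2 \<le> A * card {(x, y) \<in> Q \<times> Q. x mod q = y mod q}"
      unfolding A_def by (rule card_square_le_collisions) (simp add: Q_def)
    also have "\<dots> \<le> A * (card Q + 2 * S)"
      using card_cong_pairs_le[OF q(1), of N] by (intro mult_left_mono) (auto simp: Q_def S_def)
    finally have "real ((card Q)\<^sup>2) \<le> real (A * (card Q + 2 * S))" by (rule of_nat_mono)
    then have CS: "(real (card Q))\<^sup>2 \<le> real A * (real (card Q) + 2 * real S)" by simp
    have "a\<^sup>2 / (a + 2 * s) * \<phi> * (real (card Q) + 2 * (s * \<phi>)) \<le> (real (card Q))\<^sup>2"
    proof -
      \<comment> \<open>Monotonicity of t^2 / (t + 2 s \<phi>) in t, cleared of denominators: only a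
        \<phi> <= \<open>card Q\<close> is used in each monomial.\<close>
      have "a * (a * \<phi>) * real (card Q) + 2 * s * (a * \<phi>)\<^sup>2 \<le>
          a * real (card Q) * real (card Q) + 2 * s * (real (card Q))\<^sup>2"
        using P a s \<phi> by (intro add_mono mult_mono power_mono) auto
      then have "a\<^sup>2 * \<phi> * (real (card Q) + 2 * (s * \<phi>)) \<le> (real (card Q))\<^sup>2 * (a + 2 * s)"
        by (simp add: algebra_simps power2_eq_square)
      then show ?thesis using a s by (simp add: pos_divide_le_eq)
    qed
    also note CS
    also have "real A * (real (card Q) + 2 * real S) \<le> real A * (real (card Q) + 2 * (s * \<phi>))"
      using S by (intro mult_left_mono) auto
    finally have main: "a\<^sup>2 / (a + 2 * s) * \<phi> \<le> real A"
    proof (rule mult_right_le_imp_le)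
      show "0 < real (card Q) + 2 * (s * \<phi>)" using s \<phi> by (intro add_nonneg_pos) auto
    qed
    show ?case
    proof (intro allI impI)
      fix X assume "X \<ge> lam * real (totient q) * ln (real q)"
      then have "N \<le> nat \<lceil>X\<rceil>" unfolding N_def X0_def \<phi>_def x_def by (intro nat_mono ceiling_mono)
      then have "A \<le> prime_residue_count X q"
        unfolding A_def prime_residue_count_eq[OF q(1)] Q_def by (intro card_mono image_mono) auto
      then show "real (prime_residue_count X q) \<ge> a\<^sup>2 / (a + 2 * s) * real (totient q)"
        using main unfolding \<phi>_def by linarith
    qed
  qed
qed

text \<open>Each counted class uses up a prime below X. At level q^(1/16) the main term is 32 N / ln
  q, so c/128 leaves (c/4) \<phi>(q); the error terms receive another c/4, and the total stays below
  c \<phi>(q).\<close>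

lemma prime_residue_count_upper:
  assumes "c > 0"
  shows "\<forall>\<^sub>F q in sequentially. \<forall>X. real (prime_residue_count X q) \<ge> c * real (totient q) \<longrightarrow>
      X \<ge> c / 128 * real (totient q) * ln (real q)"
proof -
  have "\<forall>\<^sub>F q::nat in sequentially. real q \<ge> 2"
    and "\<forall>\<^sub>F q::nat in sequentially. 32 * (1 + real q powr (1 / 16)) / ln (real q) + 2 * real q powr (1 / 4)
      \<le> c / 4 * (real q / (log 2 (real q) + 1))"
    using assms by real_asymp+
  then show ?thesis
  proof eventually_elim
    case (elim q)
    define x where "x = real q"
    define \<phi> where "\<phi> = real (totient q)"
    define R where "R = nat \<lfloor>x powr (1 / 16)\<rfloor>"
    have q: "q > 0" "x \<ge> 2" using elim by (auto simp: x_def)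
    have lx: "ln x > 0" using q by simp
    have \<phi>: "\<phi> > 0" using q by (auto simp: \<phi>_def)
    have tot: "x / (log 2 x + 1) \<le> \<phi>" using totient_ge[OF q(1)] by (simp add: x_def \<phi>_def)
    have R: "R > 0" "ln x / 16 \<le> ln (real R + 1)"
      using nat_floor_powr_bounds(1,2)[of x "1 / 16"] q by (auto simp: R_def)
    have R1: "real R \<le> x powr (1 / 16)" and R4: "real R ^ 4 \<le> x powr (1 / 4)"
      using nat_floor_powr_bounds(3)[of x "1 / 16" 1] nat_floor_powr_bounds(3)[of x "1 / 16" 4] q
      by (simp_all add: R_def)
    have "real R \<le> real R ^ 4" using R by (intro self_le_power) auto
    then have R14: "real R \<le> x powr (1 / 4)" using R4 by linarith
    show ?case
    proof (intro allI impI, rule ccontr)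
      fix X assume big: "real (prime_residue_count X q) \<ge> c * real (totient q)"
        and "\<not> X \<ge> c / 128 * real (totient q) * ln (real q)"
      then have X: "X < c / 128 * \<phi> * ln x" by (simp add: \<phi>_def x_def)
      define N where "N = nat \<lceil>X\<rceil>"
      \<comment> \<open>Positivity covers X <= 0, where \<open>N\<close> is 0; the + 1 in the next
        bound is the cost of the ceiling.\<close>
      have pos: "c / 128 * \<phi> * ln x > 0" using assms \<phi> lx by simp
      then have N: "real N \<le> c / 128 * \<phi> * ln x + 1" using X unfolding N_def by linarith
      have "real (prime_residue_count X q) \<le> real (card {p. p < N \<and> prime p})"
        unfolding prime_residue_count_eq[OF q(1)] N_def by (intro of_nat_mono card_image_le) auto
      also have "\<dots> \<le> 2 * (real N + real R) / ln (real R + 1) + real R ^ 4 + real R"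
        by (rule card_primes_le) fact
      also have "\<dots> \<le> 2 * ((c / 128 * \<phi> * ln x + 1) + x powr (1 / 16)) / (ln x / 16)
          + x powr (1 / 4) + x powr (1 / 4)"
      proof (intro add_mono frac_le mult_left_mono)
        show "0 \<le> 2 * (c / 128 * \<phi> * ln x + 1 + x powr (1 / 16))"
          using pos by (intro mult_nonneg_nonneg[OF _ add_nonneg_nonneg] add_nonneg_nonneg less_imp_le[OF pos]) auto
      qed (use N R R1 R4 R14 lx in auto)
      also have "\<dots> = c / 4 * \<phi> + (32 * (1 + x powr (1 / 16)) / ln x + 2 * x powr (1 / 4))"
        using lx by (simp add: field_simps)
      also have "\<dots> \<le> c / 4 * \<phi> + c / 4 * (x / (log 2 x + 1))"
        using elim by (intro add_left_mono) (simp add: x_def)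
      also have "\<dots> \<le> c / 4 * \<phi> + c / 4 * \<phi>"
        using tot assms by (intro add_left_mono mult_left_mono) auto
      also have "\<dots> < c * \<phi>" using assms \<phi> by simp
      finally show False using big by (simp add: \<phi>_def)
    qed
  qed
qed

theorem theorem1p4:
  "(\<forall>lam::real. lam > 0 \<longrightarrow>
      (\<exists>c::real. c > 0 \<and> (\<exists>q0::nat. \<forall>q::nat. q > 0 \<longrightarrow> q \<ge> q0 \<longrightarrow>
        (\<forall>X::real. X > 0 \<longrightarrow> X \<ge> lam * real (totient q) * ln (real q) \<longrightarrow>
          real (prime_residue_count X q) \<ge> c * real (totient q)))))
   \<and>
   (\<forall>c::real. c > 0 \<longrightarrow>
      (\<exists>c'::real. c' > 0 \<and> (\<exists>q0::nat. \<forall>q::nat. q > 0 \<longrightarrow> q \<ge> q0 \<longrightarrow>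
        (\<forall>X::real. X > 0 \<longrightarrow> real (prime_residue_count X q) \<ge> c * real (totient q) \<longrightarrow>
          X \<ge> c' * real (totient q) * ln (real q)))))"
proof (intro conjI allI impI)
  fix lam :: real assume "lam > 0"
  then obtain c where "c > 0" "\<forall>\<^sub>F q in sequentially. \<forall>X \<ge> lam * real (totient q) * ln (real q).
      real (prime_residue_count X q) \<ge> c * real (totient q)"
    by (rule prime_residue_count_lower)
  then show "\<exists>c::real. c > 0 \<and> (\<exists>q0::nat. \<forall>q::nat. q > 0 \<longrightarrow> q \<ge> q0 \<longrightarrow>
        (\<forall>X::real. X > 0 \<longrightarrow> X \<ge> lam * real (totient q) * ln (real q) \<longrightarrow>
          real (prime_residue_count X q) \<ge> c * real (totient q)))"
    unfolding eventually_sequentially by blast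
next
  fix c :: real assume c: "c > 0"
  then have "c / 128 > 0" by simp
  then show "\<exists>c'::real. c' > 0 \<and> (\<exists>q0::nat. \<forall>q::nat. q > 0 \<longrightarrow> q \<ge> q0 \<longrightarrow>
        (\<forall>X::real. X > 0 \<longrightarrow> real (prime_residue_count X q) \<ge> c * real (totient q) \<longrightarrow>
          X \<ge> c' * real (totient q) * ln (real q)))"
    using prime_residue_count_upper[OF c] unfolding eventually_sequentially by blast
qed

end
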